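(* Let $(P_1,Q_1)\neq(P_2,Q_2)$ be non-degenerate integer pairs with $P_i>0$ and $|Q_i|=1$ ($i=1,2$). The following are equivalent: (i) the intersection $\{U_n(P_1,Q_1):n\ge0\}\cap\{U_n(P_2,Q_2):n\ge0\}$ is infinite; (ii) $P_1^2-4Q_1=P_2^2-4Q_2$; (iii) $\{(P_1,Q_1),(P_2,Q_2)\}=\{(1,-1),(3,1)\}$, i.e. the two sequences are the Fibonacci numbers $U_n(1,-1)$ and $U_n(3,1)=U_{2n}(1,-1)$. In that case the intersection equals $\{U_n(3,1):n\ge0\}$.
   Context: For integers $P,Q$, the Lucas sequences are defined by $U_0(P,Q)=0$, $U_1(P,Q)=1$, $V_0(P,Q)=2$, $V_1(P,Q)=P$, and for $n\ge1$: $U_{n+1}=P\,U_n-Q\,U_{n-1}$, $V_{n+1}=P\,V_n-Q\,V_{n-1}$. The discriminant of $(P,Q)$ is $P^2-4Q$. A pair $(P,Q)$ (and its sequences) is called degenerate if $(P,Q)\in\{(0,1),(0,-1),(1,1),(2,1)\}$, and non-degenerate otherwise. *)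

theory Defs
  imports Main
begin

fun lucasU :: "int \<Rightarrow> int \<Rightarrow> nat \<Rightarrow> int" where
  "lucasU P Q 0 = 0"
| "lucasU P Q (Suc 0) = 1"
| "lucasU P Q (Suc (Suc n)) = P * lucasU P Q (Suc n) - Q * lucasU P Q n"

definition degenerate :: "int \<Rightarrow> int \<Rightarrow> bool" where
  "degenerate P Q \<longleftrightarrow> (P, Q) \<in> {(0, 1), (0, -1), (1, 1), (2, 1)}"

end

theory Submission
  imports Defs "HOL-Analysis.Analysis" "HOL-Computational_Algebra.Field_as_Ring"
    "HOL-Computational_Algebra.Polynomial_Factorial"
begin

text \<open>With \<open>D = P\<^sup>2 - 4 Q\<close>, every term \<open>u\<close> of the sequence makes \<open>D u\<^sup>2 + 4\<close> or \<open>D u\<^sup>2 - 4\<close> a square. Hence infinitely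
  many common terms give infinitely many solutions of one pair of equations \<open>y\<^sup>2 = D1 x\<^sup>2 + e1\<close>,
  \<open>z\<^sup>2 = D2 x\<^sup>2 + e2\<close>, and it suffices to show that such a pair has finitely many solutions unless
  \<open>e1 D2 = e2 D1\<close>. Fix one large solution \<open>(x0, y0, z0)\<close> and put \<open>N = D1 D2 x0\<^sup>2\<close>. For each of the
  nodes \<open>0\<close>, \<open>e1 D2\<close>, \<open>e2 D1\<close>, written \<open>a l\<close>, the number \<open>sqrt (1 + a l / N)\<close> is a rational multiple of
  \<open>1\<close>, \<open>sqrt D1\<close>, \<open>sqrt D2\<close>, so any other solution \<open>(x, y, z)\<close> approximates the three of them
  simultaneously with a denominator of order \<open>x\<close> and error of order \<open>1/x\<^sup>2\<close>. Divided differences of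
  \<open>(1 + z / N)\<close> to the power \<open>K - 1/2\<close> at the three nodes, each with multiplicity about \<open>K\<close>, are linear
  forms in these square roots. Up to factors exponential in \<open>K\<close> their coefficients become integers of size
  \<open>N ^ K\<close>, while their values have size \<open>N\<close> to the power \<open>-2 K\<close>. Evaluated at the rational approximations, one
  of them is nonzero because of the differential equation of the power function, and for \<open>N\<close> large
  this bounds \<open>x\<close>.\<close>

section \<open>Divided differences at three nodes\<close>

context
  fixes a :: "nat \<Rightarrow> real" and F :: "nat \<Rightarrow> nat \<Rightarrow> real"
begin

text \<open>The divided difference at the nodes \<open>a 0\<close>, \<open>a 1\<close>, \<open>a 2\<close> with multiplicities \<open>i\<close>, \<open>j\<close>, \<open>k\<close>
  of a function whose Taylor coefficients at \<open>a l\<close> are \<open>F l\<close>.\<close>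

fun divdiff :: "nat \<Rightarrow> nat \<Rightarrow> nat \<Rightarrow> real" where
  "divdiff (Suc i) (Suc j) k = (divdiff i (Suc j) k - divdiff (Suc i) j k) / (a 1 - a 0)"
| "divdiff (Suc i) 0 (Suc k) = (divdiff i 0 (Suc k) - divdiff (Suc i) 0 k) / (a 2 - a 0)"
| "divdiff 0 (Suc j) (Suc k) = (divdiff 0 j (Suc k) - divdiff 0 (Suc j) k) / (a 2 - a 1)"
| "divdiff (Suc i) 0 0 = F 0 i"
| "divdiff 0 (Suc j) 0 = F 1 j"
| "divdiff 0 0 (Suc k) = F 2 k"
| "divdiff 0 0 0 = 0"

end

text \<open>Nodes at distance at least 1 make every division harmless, so each step of the recursion
  at most doubles the bound.\<close>

lemma divdiff_bound:
  assumes "\<bar>a 1 - a 0\<bar> \<ge> 1" "\<bar>a 2 - a 0\<bar> \<ge> 1" "\<bar>a 2 - a 1\<bar> \<ge> 1"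
    and "\<And>l s. l < 3 \<Longrightarrow> s < K \<Longrightarrow> \<bar>F l s\<bar> \<le> M" and "M \<ge> 0"
    and "i \<le> K" "j \<le> K" "k \<le> K"
  shows "\<bar>divdiff a F i j k\<bar> \<le> 2 ^ (i + j + k) * M"
proof -
  have step: "\<bar>(X - Y) / d\<bar> \<le> 2 ^ Suc n * M"
    if "\<bar>X\<bar> \<le> 2 ^ n * M" "\<bar>Y\<bar> \<le> 2 ^ n * M" "\<bar>d\<bar> \<ge> 1" for X Y d :: real and n
  proof -
    have "\<bar>(X - Y) / d\<bar> = \<bar>X - Y\<bar> / \<bar>d\<bar>" by simp
    also have "\<dots> \<le> \<bar>X - Y\<bar>" using that(3) frac_le[of "\<bar>X - Y\<bar>" "\<bar>X - Y\<bar>" 1 "\<bar>d\<bar>"] by simp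
    also have "\<dots> \<le> 2 ^ Suc n * M" using that(1,2) by simp
    finally show ?thesis .
  qed
  have base: "x \<le> M \<Longrightarrow> x \<le> 2 ^ n * M" for x and n :: nat
    using assms(5) mult_right_mono[of 1 "2 ^ n" M] by fastforce
  show ?thesis
    using assms(6-)
  proof (induction i j k rule: divdiff.induct)
    case (1 i j k)
    then show ?case using step[OF _ _ assms(1), of "divdiff a F i (Suc j) k" "i + j + k + 1" "divdiff a F (Suc i) j k"]
      by (simp del: power_Suc)
  next
    case (2 i k)
    then show ?case using step[OF _ _ assms(2), of "divdiff a F i 0 (Suc k)" "i + k + 1" "divdiff a F (Suc i) 0 k"]
      by (simp del: power_Suc)
  next
    case (3 j k)
    then show ?case using step[OF _ _ assms(3), of "divdiff a F 0 j (Suc k)" "j + k + 1" "divdiff a F 0 (Suc j) k"]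
      by (simp del: power_Suc)
  qed (use assms in \<open>auto intro!: base simp del: power_Suc\<close>)
qed

text \<open>Every denominator in the recursion is a factor of the product of the three node
  differences, so one copy of that product per step clears it, once \<open>E\<close> has cleared the
  Taylor coefficients.\<close>

lemma divdiff_Ints:
  assumes "\<And>l. a l \<in> \<int>" and "a 1 \<noteq> a 0" "a 2 \<noteq> a 0" "a 2 \<noteq> a 1"
    and "\<And>l s. l < 3 \<Longrightarrow> s < K \<Longrightarrow> E * F l s \<in> \<int>"
    and "i \<le> K" "j \<le> K" "k \<le> K"
  shows "E * ((a 1 - a 0) * (a 2 - a 0) * (a 2 - a 1)) ^ (i + j + k) * divdiff a F i j k \<in> \<int>"
proof -
  define \<delta> where "\<delta> = (a 1 - a 0) * (a 2 - a 0) * (a 2 - a 1)"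
  have step: "E * \<delta> ^ Suc n * ((X - Y) / d) \<in> \<int>"
    if "E * \<delta> ^ n * X \<in> \<int>" "E * \<delta> ^ n * Y \<in> \<int>" "d \<noteq> 0" "\<exists>e\<in>\<int>. \<delta> = d * e" for X Y d n
  proof -
    from that(4) obtain e where e: "e \<in> \<int>" "\<delta> = d * e" by blast
    have "E * \<delta> ^ Suc n * ((X - Y) / d) = (d / d) * (e * (E * \<delta> ^ n * X - E * \<delta> ^ n * Y))"
      unfolding power_Suc by (subst e(2)) (simp add: algebra_simps)
    then show ?thesis using Ints_mult[OF e(1) Ints_diff[OF that(1,2)]] that(3) by simp
  qed
  have ints: "a l - a l' \<in> \<int>" for l l' by (intro Ints_diff assms(1))
  have factors: "\<exists>e\<in>\<int>. \<delta> = (a 1 - a 0) * e" "\<exists>e\<in>\<int>. \<delta> = (a 2 - a 0) * e"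
    "\<exists>e\<in>\<int>. \<delta> = (a 2 - a 1) * e"
    using Ints_mult[OF ints[of 2 0] ints[of 2 1]] Ints_mult[OF ints[of 1 0] ints[of 2 1]]
      Ints_mult[OF ints[of 1 0] ints[of 2 0]]
    by (blast intro: \<delta>_def[unfolded mult.assoc] \<delta>_def[unfolded mult.assoc mult.left_commute[of "a 1 - a 0" "a 2 - a 0"]]
        \<delta>_def[unfolded mult.commute[of _ "a 2 - a 1"]])+
  have \<delta>: "\<delta> \<in> \<int>" unfolding \<delta>_def by (intro Ints_mult ints)
  have base: "E * \<delta> ^ n * X \<in> \<int>" if "E * X \<in> \<int>" for n X
    using Ints_mult[OF that Ints_power[OF \<delta>, of n]] by (simp add: mult_ac)
  have "E * \<delta> ^ (i + j + k) * divdiff a F i j k \<in> \<int>"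
    using assms(6-)
  proof (induction i j k rule: divdiff.induct)
    case (1 i j k)
    then show ?case
      using step[OF _ _ _ factors(1), of "i + j + k + 1" "divdiff a F i (Suc j) k" "divdiff a F (Suc i) j k"] assms(2)
      by (auto simp del: power_Suc)
  next
    case (2 i k)
    then show ?case
      using step[OF _ _ _ factors(2), of "i + k + 1" "divdiff a F i 0 (Suc k)" "divdiff a F (Suc i) 0 k"] assms(3)
      by (auto simp del: power_Suc)
  next
    case (3 j k)
    then show ?case
      using step[OF _ _ _ factors(3), of "j + k + 1" "divdiff a F 0 j (Suc k)" "divdiff a F 0 (Suc j) k"] assms(4)
      by (auto simp del: power_Suc)
  qed (use assms in \<open>auto intro!: base simp del: power_Suc\<close>)
  then show ?thesis by (simp add: \<delta>_def)
qed

text \<open>Divided differences are finite linear combinations of Taylor coefficients, so a power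
  series can be treated term by term; \<open>c m\<close> is the same at all nodes.\<close>

lemma divdiff_sums:
  assumes "\<And>l s. l < 3 \<Longrightarrow> s < K \<Longrightarrow> (\<lambda>m. c m * G m l s) sums F l s"
    and "i \<le> K" "j \<le> K" "k \<le> K"
  shows "(\<lambda>m. c m * divdiff a (G m) i j k) sums divdiff a F i j k"
proof -
  have step: "(\<lambda>m. c m * (X m - Y m) / d) sums ((S - T) / d)"
    if "(\<lambda>m. c m * X m) sums S" "(\<lambda>m. c m * Y m) sums T" for X Y S T and d :: real
    using sums_divide[OF sums_diff[OF that], of d] by (simp add: algebra_simps)
  show ?thesis
    using assms(2-)
  proof (induction i j k rule: divdiff.induct)
  qed (use assms(1) in \<open>auto intro!: step\<close>)
qed

lemma divdiff_diff_scale: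
  "divdiff a (\<lambda>l s. F l s - q * G l s) i j k = divdiff a F i j k - q * divdiff a G i j k"
  by (induction i j k rule: divdiff.induct)
    (simp_all add: diff_divide_distrib right_diff_distrib)

section \<open>Hermite interpolation\<close>

text \<open>\<open>J l\<close> stands for the function near the node \<open>a l\<close>. Bounding
  the degree through coefficients also covers the case of multiplicities all zero, where
  \<open>H\<close> has to be 0.\<close>

definition interpolates ::
  "(nat \<Rightarrow> real) \<Rightarrow> (nat \<Rightarrow> real poly) \<Rightarrow> nat \<Rightarrow> nat \<Rightarrow> nat \<Rightarrow> real poly \<Rightarrow> bool" where
  "interpolates a J i j k H \<longleftrightarrow> (\<forall>m\<ge>i + j + k. coeff H m = 0)
     \<and> [:- a 0, 1:] ^ i dvd H - J 0 \<and> [:- a 1, 1:] ^ j dvd H - J 1 \<and> [:- a 2, 1:] ^ k dvd H - J 2"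

section \<open>Truncated Taylor expansions\<close>

definition jet :: "real \<Rightarrow> (nat \<Rightarrow> real) \<Rightarrow> nat \<Rightarrow> real poly" where
  "jet a f n = (\<Sum>s<n. smult (f s) ([:- a, 1:] ^ s))"

lemma degree_linear_power: "degree ([:- a, 1:] ^ s :: real poly) = s"
  by (simp add: degree_power_eq)

lemma coeff_linear_power_self: "coeff ([:- a, 1:] ^ s :: real poly) s = 1"
  using lead_coeff_power[of "[:- a, 1:]" s] by (simp add: degree_linear_power)

lemma coeff_jet_eq_0: "m \<ge> n \<Longrightarrow> coeff (jet a f n) m = 0"
  unfolding jet_def coeff_sum
  by (intro sum.neutral) (auto intro!: coeff_eq_0 simp: degree_linear_power)

lemma coeff_jet_top: "coeff (jet a f (Suc n)) n = f n"
  using coeff_jet_eq_0[of n n a f] by (simp add: jet_def coeff_linear_power_self)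

lemma jet_trunc_dvd:
  assumes "i \<le> n"
  shows "[:- a, 1:] ^ i dvd jet a f i - jet a f n"
proof -
  have "jet a f n = jet a f i + (\<Sum>s=i..<n. smult (f s) ([:- a, 1:] ^ s))"
    unfolding jet_def using sum.atLeastLessThan_concat[of 0 i n "\<lambda>s. smult (f s) ([:- a, 1:] ^ s)"] assms
    by (simp add: atLeast0LessThan)
  then have "jet a f i - jet a f n = - (\<Sum>s=i..<n. smult (f s) ([:- a, 1:] ^ s))"
    by (simp only: minus_add_cancel diff_add_eq_diff_diff_swap diff_diff_eq2)
  moreover have "[:- a, 1:] ^ i dvd (\<Sum>s=i..<n. smult (f s) ([:- a, 1:] ^ s))"
    by (intro dvd_sum dvd_smult le_imp_power_dvd) simp
  ultimately show ?thesis by (simp only: dvd_minus_iff)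
qed

text \<open>The Aitken-Neville combination. The weights of \<open>G\<close> and \<open>H\<close> sum
  to 1 and vanish at \<open>b\<close> and \<open>d\<close> respectively, so \<open>G\<close> may be
  one order short at \<open>b\<close> and \<open>H\<close> one order short at
  \<open>d\<close>.\<close>

definition aitken :: "real \<Rightarrow> real \<Rightarrow> real poly \<Rightarrow> real poly \<Rightarrow> real poly" where
  "aitken b d G H = smult (1 / (d - b)) ([:- b, 1:] * G - [:- d, 1:] * H)"

lemma aitken_minus:
  assumes "d \<noteq> b"
  shows "aitken b d G H - J = smult (1 / (d - b)) ([:- b, 1:] * (G - J) - [:- d, 1:] * (H - J))"
proof -
  have "J = smult (1 / (d - b)) ([:d - b:] * J)" using assms by simp
  also have "[:d - b:] = [:- b, 1:] - [:- d, 1:]" by simp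
  finally have J: "smult (1 / (d - b)) (([:- b, 1:] - [:- d, 1:]) * J) = J" by (rule sym)
  have "smult (1 / (d - b)) ([:- b, 1:] * (G - J) - [:- d, 1:] * (H - J)) =
      smult (1 / (d - b)) (([:- b, 1:] * G - [:- d, 1:] * H) - ([:- b, 1:] - [:- d, 1:]) * J)"
    by (simp only: right_diff_distrib left_diff_distrib diff_diff_eq2 diff_diff_eq add_diff_eq diff_add_eq ac_simps)
  also have "\<dots> = aitken b d G H - J" by (simp only: smult_diff_right aitken_def J)
  finally show ?thesis by (rule sym)
qed

text \<open>The leading coefficient obeys exactly the recursion of \<open>divdiff\<close>.\<close>

lemma aitken_coeff:
  assumes "\<And>m. m \<ge> Suc n \<Longrightarrow> coeff G m = 0" "\<And>m. m \<ge> Suc n \<Longrightarrow> coeff H m = 0"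
  shows "m \<ge> Suc (Suc n) \<Longrightarrow> coeff (aitken b d G H) m = 0"
    and "coeff (aitken b d G H) (Suc n) = (coeff G n - coeff H n) / (d - b)"
proof -
  show "coeff (aitken b d G H) m = 0" if "m \<ge> Suc (Suc n)"
  proof -
    define m' where "m' = m - 1"
    have "m = Suc m'" "m' \<ge> Suc n" using that by (auto simp: m'_def)
    then show ?thesis using assms(1)[of m'] assms(2)[of m'] assms(1)[of m] assms(2)[of m]
      by (simp add: aitken_def)
  qed
  show "coeff (aitken b d G H) (Suc n) = (coeff G n - coeff H n) / (d - b)"
    using assms by (simp add: aitken_def)
qed

lemma aitken_dvd:
  assumes "d \<noteq> b"
  shows "[:- b, 1:] ^ p dvd G - J \<Longrightarrow> [:- b, 1:] ^ Suc p dvd H - J \<Longrightarrow> [:- b, 1:] ^ Suc p dvd aitken b d G H - J"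
    and "[:- d, 1:] ^ Suc p dvd G - J \<Longrightarrow> [:- d, 1:] ^ p dvd H - J \<Longrightarrow> [:- d, 1:] ^ Suc p dvd aitken b d G H - J"
    and "R dvd G - J \<Longrightarrow> R dvd H - J \<Longrightarrow> R dvd aitken b d G H - J"
proof -
  show "R dvd aitken b d G H - J" if "R dvd G - J" "R dvd H - J"
    unfolding aitken_minus[OF assms] by (intro dvd_smult dvd_diff dvd_mult that)
  show "[:- b, 1:] ^ Suc p dvd aitken b d G H - J"
    if "[:- b, 1:] ^ p dvd G - J" "[:- b, 1:] ^ Suc p dvd H - J"
    unfolding aitken_minus[OF assms]
    by (intro dvd_smult dvd_diff) (simp_all only: power_Suc mult_dvd_mono that(1) dvd_refl dvd_mult[OF that(2)[unfolded power_Suc]])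
  show "[:- d, 1:] ^ Suc p dvd aitken b d G H - J"
    if "[:- d, 1:] ^ Suc p dvd G - J" "[:- d, 1:] ^ p dvd H - J"
    unfolding aitken_minus[OF assms]
    by (intro dvd_smult dvd_diff) (simp_all only: power_Suc mult_dvd_mono that(2) dvd_refl dvd_mult[OF that(1)[unfolded power_Suc]])
qed

text \<open>At a single node the jet itself interpolates; from there the Aitken step raises the
  multiplicities along the recursion of \<open>divdiff\<close>, which thereby computes the leading
  coefficient.\<close>

lemma hermite_interpolation:
  fixes a :: "nat \<Rightarrow> real"
  assumes "a 1 \<noteq> a 0" "a 2 \<noteq> a 0" "a 2 \<noteq> a 1"
    and "i \<le> K" "j \<le> K" "k \<le> K" "i + j + k > 0"
  shows "\<exists>H. interpolates a (\<lambda>l. jet (a l) (F l) K) i j k H \<and> coeff H (i + j + k - 1) = divdiff a F i j k"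
  using assms(4-)
proof (induction i j k rule: divdiff.induct)
  case (1 i j k)
  then obtain G H where
    "interpolates a (\<lambda>l. jet (a l) (F l) K) i (Suc j) k G"
    "interpolates a (\<lambda>l. jet (a l) (F l) K) (Suc i) j k H"
    and c: "coeff G (i + j + k) = divdiff a F i (Suc j) k" "coeff H (i + j + k) = divdiff a F (Suc i) j k"
    by fastforce
  then show ?case using assms(1-3)
    by (intro exI[of _ "aitken (a 0) (a 1) G H"])
      (auto simp: interpolates_def aitken_coeff[of "i + (j + k)"] add.assoc simp del: power_Suc One_nat_def intro: aitken_dvd)
next
  case (2 i k)
  then obtain G H where
    "interpolates a (\<lambda>l. jet (a l) (F l) K) i 0 (Suc k) G"
    "interpolates a (\<lambda>l. jet (a l) (F l) K) (Suc i) 0 k H"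
    and c: "coeff G (i + k) = divdiff a F i 0 (Suc k)" "coeff H (i + k) = divdiff a F (Suc i) 0 k"
    by fastforce
  then show ?case using assms(1-3)
    by (intro exI[of _ "aitken (a 0) (a 2) G H"])
      (auto simp: interpolates_def aitken_coeff[of "i + k"] simp del: power_Suc One_nat_def intro: aitken_dvd)
next
  case (3 j k)
  then obtain G H where
    "interpolates a (\<lambda>l. jet (a l) (F l) K) 0 j (Suc k) G"
    "interpolates a (\<lambda>l. jet (a l) (F l) K) 0 (Suc j) k H"
    and c: "coeff G (j + k) = divdiff a F 0 j (Suc k)" "coeff H (j + k) = divdiff a F 0 (Suc j) k"
    by fastforce
  then show ?case using assms(1-3)
    by (intro exI[of _ "aitken (a 1) (a 2) G H"])
      (auto simp: interpolates_def aitken_coeff[of "j + k"] simp del: power_Suc One_nat_def intro: aitken_dvd)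
next
  case (4 i)
  then show ?case
    by (intro exI[of _ "jet (a 0) (F 0) (Suc i)"])
      (auto simp: interpolates_def coeff_jet_eq_0 coeff_jet_top jet_trunc_dvd simp del: power_Suc)
next
  case (5 j)
  then show ?case
    by (intro exI[of _ "jet (a 1) (F 1) (Suc j)"])
      (auto simp: interpolates_def coeff_jet_eq_0 coeff_jet_top jet_trunc_dvd simp del: power_Suc)
next
  case (6 k)
  then show ?case
    by (intro exI[of _ "jet (a 2) (F 2) (Suc k)"])
      (auto simp: interpolates_def coeff_jet_eq_0 coeff_jet_top jet_trunc_dvd simp del: power_Suc)
qed auto

section \<open>Uniqueness of the interpolant\<close>

lemma linear_powers_coprime:
  fixes a b :: real
  assumes "a \<noteq> b"
  shows "coprime ([:- a, 1:] ^ i) ([:- b, 1:] ^ j)"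
proof -
  have "coprime [:- a, 1:] [:- b, 1:]"
  proof (rule coprimeI)
    fix c assume "c dvd [:- a, 1:]" "c dvd [:- b, 1:]"
    then have "c dvd [:- a, 1:] - [:- b, 1:]" by (rule dvd_diff)
    also have "[:- a, 1:] - [:- b, 1:] = [:b - a:]" by simp
    finally show "is_unit c" using assms dvd_trans[of c "[:b - a:]" 1]
      by (simp add: is_unit_const_poly_iff dvd_field_iff)
  qed
  then show ?thesis by simp
qed

lemma three_node_zero:
  fixes a :: "nat \<Rightarrow> real"
  assumes "a 1 \<noteq> a 0" "a 2 \<noteq> a 0" "a 2 \<noteq> a 1"
    and "\<And>m. m \<ge> i + j + k \<Longrightarrow> coeff G m = 0"
    and "[:- a 0, 1:] ^ i dvd G" "[:- a 1, 1:] ^ j dvd G" "[:- a 2, 1:] ^ k dvd G"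
  shows "G = 0"
proof (rule ccontr)
  assume "G \<noteq> 0"
  have "[:- a 0, 1:] ^ i * [:- a 1, 1:] ^ j * [:- a 2, 1:] ^ k dvd G"
    using assms(1-3)
    by (intro divides_mult assms coprime_mult_left_iff[THEN iffD2] conjI linear_powers_coprime) auto
  then have "degree ([:- a 0, 1:] ^ i * [:- a 1, 1:] ^ j * [:- a 2, 1:] ^ k) \<le> degree G"
    using \<open>G \<noteq> 0\<close> by (rule dvd_imp_degree_le)
  then have "i + j + k \<le> degree G"
    by (simp add: degree_mult_eq degree_linear_power)
  then show False using assms(4)[of "degree G"] \<open>G \<noteq> 0\<close> by simp
qed

text \<open>By \<open>three_node_zero\<close> the interpolant is unique, so the divided difference
  can be read off from any polynomial known to interpolate.\<close>

lemma interpolates_coeff: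
  assumes "a 1 \<noteq> a 0" "a 2 \<noteq> a 0" "a 2 \<noteq> a 1"
    and "i \<le> K" "j \<le> K" "k \<le> K" "i + j + k > 0"
    and H: "interpolates a (\<lambda>l. jet (a l) (F l) K) i j k H"
  shows "coeff H (i + j + k - 1) = divdiff a F i j k"
proof -
  obtain G where G: "interpolates a (\<lambda>l. jet (a l) (F l) K) i j k G" "coeff G (i + j + k - 1) = divdiff a F i j k"
    using hermite_interpolation[OF assms(1-7)] by blast
  have d: "R dvd H - G" if "R dvd H - J" "R dvd G - J" for R J
    using dvd_diff[OF that] by simp
  have "H - G = 0"
    using three_node_zero[OF assms(1-3), of i j k "H - G"] H G(1)
    unfolding interpolates_def by (auto intro: d)
  then show ?thesis using G(2) by simp
qed

section \<open>Half-integral powers\<close>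

text \<open>For \<open>e = 1 + x * a\<close> and \<open>s < K\<close>, multiplication by \<open>sqrt e\<close> gives the Taylor coefficients
  at \<open>a\<close> of \<open>1 + x z\<close> to the power \<open>K - 1/2\<close>.\<close>

definition sqrt_jet :: "nat \<Rightarrow> real \<Rightarrow> real \<Rightarrow> nat \<Rightarrow> real" where
  "sqrt_jet K x e s = (real K - 1 / 2 gchoose s) * x ^ s * e ^ (K - 1 - s)"

lemma sqrt_jet_Suc:
  assumes "Suc n < K"
  shows "real (Suc n) * e * sqrt_jet K x e (Suc n) = x * (real K - 1 / 2 - real n) * sqrt_jet K x e n"
proof -
  have e: "e ^ (K - Suc n) = e * e ^ (K - Suc (Suc n))"
    using assms by (metis Suc_diff_Suc power_Suc)
  have "real (Suc n) * (real K - 1 / 2 gchoose Suc n) = (real K - 1 / 2 - real n) * (real K - 1 / 2 gchoose n)"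
    using gbinomial_mult_1[of "real K - 1 / 2" n] by (simp add: algebra_simps)
  then have "(real (Suc n) * (real K - 1 / 2 gchoose Suc n)) * (e * x * x ^ n * e ^ (K - Suc (Suc n)))
      = ((real K - 1 / 2 - real n) * (real K - 1 / 2 gchoose n)) * (e * x * x ^ n * e ^ (K - Suc (Suc n)))"
    by simp
  then show ?thesis using e by (simp add: sqrt_jet_def mult_ac del: of_nat_Suc)
qed

text \<open>The equation \<open>(1 + x z) f' = (K - 1/2) x f\<close> of the power function, to one order less than the jet.\<close>

lemma jet_ode_dvd:
  fixes x a t :: real and K :: nat
  defines "J \<equiv> jet a (\<lambda>s. t * sqrt_jet K x (1 + x * a) s) K"
  assumes "K > 0"
  shows "[:- a, 1:] ^ (K - 1) dvd [:1, x:] * pderiv J - smult ((real K - 1 / 2) * x) J"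
proof -
  define p where "p = [:- a, 1:]"
  define e where "e = 1 + x * a"
  define f where "f s = t * sqrt_jet K x e s" for s
  define \<alpha> where "\<alpha> = real K - 1 / 2"
  define L where "L q = [:1, x:] * pderiv q - smult (\<alpha> * x) q" for q :: "real poly"
  have w: "[:1, x:] = [:e:] + smult x p" by (simp add: e_def p_def)
  have L_add: "L (q + r) = L q + L r" for q r
    by (simp add: L_def pderiv_add algebra_simps smult_add_right)
  have L_term: "L (smult c (p ^ Suc s)) = smult (c * real (Suc s) * e) (p ^ s) + smult (c * x * (real (Suc s) - \<alpha>)) (p ^ Suc s)" for c s
  proof -
    have "pderiv (p ^ Suc s) = smult (real (Suc s)) (p ^ s)"
      unfolding pderiv_power_Suc by (simp add: p_def pderiv_pCons)
    then have "L (smult c (p ^ Suc s)) =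
        smult (c * real (Suc s)) (([:e:] + smult x p) * p ^ s) - smult (\<alpha> * x * c) (p ^ Suc s)"
      unfolding L_def w by (simp add: pderiv_smult mult_ac)
    also have "\<dots> = smult (c * real (Suc s) * e) (p ^ s) +
        (smult (c * real (Suc s) * x) (p ^ Suc s) - smult (\<alpha> * x * c) (p ^ Suc s))"
      by (simp only: distrib_right smult_add_right) (simp add: smult_add_right algebra_simps del: of_nat_Suc)
    also have "smult (c * real (Suc s) * x) (p ^ Suc s) - smult (\<alpha> * x * c) (p ^ Suc s) =
        smult (c * x * (real (Suc s) - \<alpha>)) (p ^ Suc s)"
      by (simp only: smult_diff_left[symmetric]) (simp add: algebra_simps)
    finally show ?thesis .
  qed
  \<comment> \<open>By \<open>sqrt_jet_Suc\<close> the contributions of consecutive terms to each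
    power of \<open>p\<close> cancel, and only the one at the truncation survives.\<close>
  have "L (\<Sum>s<Suc n. smult (f s) (p ^ s)) = smult (f n * x * (real n - \<alpha>)) (p ^ n)" if "n < K" for n
    using that
  proof (induction n)
    case 0
    show ?case by (simp add: L_def pderiv_smult mult_ac)
  next
    case (Suc n)
    have eq: "f (Suc n) * real (Suc n) * e = f n * x * (\<alpha> - real n)"
      using sqrt_jet_Suc[OF Suc.prems, of e x] unfolding f_def \<alpha>_def by (simp add: mult_ac)
    have "smult (f n * x * (real n - \<alpha>)) (p ^ n) + smult (f n * x * (\<alpha> - real n)) (p ^ n) = 0"
      by (simp only: smult_add_left[symmetric]) (simp add: algebra_simps)
    then show ?case
      using Suc by (simp add: sum.lessThan_Suc[of _ "Suc n"] L_add L_term eq add.assoc[symmetric] del: sum.lessThan_Suc of_nat_Suc power_Suc)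
  qed
  from this[of "K - 1"] have "L J = smult (f (K - 1) * x * (real (K - 1) - \<alpha>)) (p ^ (K - 1))"
    using assms(2) by (simp add: J_def jet_def f_def e_def p_def)
  then show ?thesis
    unfolding L_def \<alpha>_def p_def by (simp only: dvd_smult dvd_refl)
qed

section \<open>Nonvanishing of one of three consecutive divided differences\<close>

lemma poly_jet_node: "K > 0 \<Longrightarrow> poly (jet a f K) a = f 0"
proof (induction K)
  case (Suc K)
  then show ?case by (cases "K = 0") (auto simp: jet_def)
qed simp

lemma pderiv_pow_dvd:
  fixes p q :: "real poly"
  assumes "p ^ n dvd q"
  shows "p ^ (n - 1) dvd pderiv q"
proof (cases n)
  case (Suc m)
  obtain r where r: "q = p ^ Suc m * r" using assms Suc by auto
  have "p ^ m dvd p ^ Suc m * pderiv r" "p ^ m dvd r * pderiv (p ^ Suc m)"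
    unfolding pderiv_power_Suc by (simp_all add: dvd_mult dvd_mult2 dvd_smult)
  then show ?thesis
    unfolding r pderiv_mult Suc diff_Suc_1 by (rule dvd_add)
qed simp

text \<open>Three vanishing leading coefficients push the degree of the interpolant \<open>H\<close>
  below 3 (K - 1). The differential operator \<open>L\<close> then maps \<open>H\<close> to a
  polynomial of degree below 3 (K - 1) that vanishes to order K - 1 at each node, so
  \<open>H\<close> solves the differential equation of the power function exactly. No nonzero
  polynomial does, since the exponent K - 1/2 is not an integer.\<close>

lemma divdiff_sqrt_nonzero:
  fixes a t :: "nat \<Rightarrow> real" and x :: real and K :: nat
  defines "F \<equiv> \<lambda>l s. t l * sqrt_jet K x (1 + x * a l) s"
  assumes distinct: "a 1 \<noteq> a 0" "a 2 \<noteq> a 0" "a 2 \<noteq> a 1"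
    and "K > 0" "x \<noteq> 0" and e: "1 + x * a 0 \<noteq> 0"
    and zero: "divdiff a F K K K = 0" "divdiff a F (K - 1) K K = 0" "divdiff a F (K - 1) (K - 1) K = 0"
  shows "t 0 = 0"
proof -
  let ?J = "\<lambda>l. jet (a l) (F l) K"
  define \<alpha> where "\<alpha> = real K - 1 / 2"
  obtain H where H: "interpolates a ?J K K K H" "coeff H (3 * K - 1) = 0"
    using hermite_interpolation[OF distinct, of K K K K F] \<open>K > 0\<close> zero(1)
    by (auto simp: numeral_eq_Suc add.assoc)
  have weaken: "[:- a 0, 1:] ^ (K - 1) dvd H - ?J 0" "[:- a 1, 1:] ^ (K - 1) dvd H - ?J 1"
    using H(1) unfolding interpolates_def by (meson diff_le_self power_le_dvd)+
  have c1: "coeff H m = 0" if "m \<ge> 3 * K - 1" for m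
    using H that \<open>K > 0\<close> unfolding interpolates_def by (cases "m = 3 * K - 1") (auto simp: numeral_eq_Suc add.assoc)
  \<comment> \<open>Having lost its top coefficient, the same \<open>H\<close> is also the
    interpolant for one multiplicity less, so the next divided difference is its next
    coefficient.\<close>
  have i1: "interpolates a ?J (K - 1) K K H"
    using H(1) c1 weaken \<open>K > 0\<close> unfolding interpolates_def by (auto simp: numeral_eq_Suc add.assoc)
  have c2: "coeff H m = 0" if "m \<ge> 3 * K - 2" for m
    using interpolates_coeff[OF distinct _ _ _ _ i1] c1 zero(2) that \<open>K > 0\<close>
    by (cases "m = 3 * K - 2") (auto simp: numeral_eq_Suc add.assoc)
  have i2: "interpolates a ?J (K - 1) (K - 1) K H"
    using i1 c2 weaken \<open>K > 0\<close> unfolding interpolates_def by (auto simp: numeral_eq_Suc add.assoc)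
  have c3: "coeff H m = 0" if "m \<ge> 3 * (K - 1)" for m
    using interpolates_coeff[OF distinct _ _ _ _ i2] c2 zero(3) that \<open>K > 0\<close>
    by (cases "m = 3 * (K - 1)") (auto simp: numeral_eq_Suc add.assoc)
  define L where "L q = [:1, x:] * pderiv q - smult (\<alpha> * x) q" for q :: "real poly"
  have L_coeff: "coeff (L q) m = real (Suc m) * coeff q (Suc m) + x * (real m - \<alpha>) * coeff q m" for q m
    by (cases m) (simp_all add: L_def coeff_pderiv algebra_simps)
  have L_dvd: "[:- a l, 1:] ^ (K - 1) dvd L H" if "[:- a l, 1:] ^ K dvd H - ?J l" for l
  proof -
    have "[:- a l, 1:] ^ (K - 1) dvd H - ?J l"
      using that by (meson diff_le_self power_le_dvd)
    then have "[:- a l, 1:] ^ (K - 1) dvd [:1, x:] * pderiv (H - ?J l) - smult (\<alpha> * x) (H - ?J l)"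
      by (rule dvd_diff[OF dvd_mult[OF pderiv_pow_dvd[OF that]] dvd_smult])
    moreover have "[:- a l, 1:] ^ (K - 1) dvd L (?J l)"
      unfolding L_def \<alpha>_def F_def using jet_ode_dvd[OF \<open>K > 0\<close>] by blast
    ultimately have "[:- a l, 1:] ^ (K - 1) dvd
        ([:1, x:] * pderiv (H - ?J l) - smult (\<alpha> * x) (H - ?J l)) + L (?J l)"
      by (rule dvd_add)
    also have "\<dots> = L H"
      unfolding L_def pderiv_diff right_diff_distrib smult_diff_right by algebra
    finally show ?thesis .
  qed
  have "L H = 0"
  proof (rule three_node_zero[OF distinct])
    show "coeff (L H) m = 0" if "m \<ge> (K - 1) + (K - 1) + (K - 1)" for m
      using c3[of m] c3[of "Suc m"] that by (simp add: L_coeff)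
  qed (use H(1) in \<open>auto intro!: L_dvd simp: interpolates_def simp del: One_nat_def\<close>)
  \<comment> \<open>The leading coefficient of \<open>L H\<close> is zero only if the degree of
    \<open>H\<close> equals K - 1/2.\<close>
  have "H = 0"
  proof (rule ccontr)
    assume "H \<noteq> 0"
    have "x * (real (degree H) - \<alpha>) * coeff H (degree H) = 0"
      using L_coeff[of H "degree H"] \<open>L H = 0\<close> by (simp add: coeff_eq_0)
    then have "real (degree H) = \<alpha>" using \<open>H \<noteq> 0\<close> \<open>x \<noteq> 0\<close> by simp
    then have "real (2 * degree H + 1) = real (2 * K)" by (simp add: \<alpha>_def)
    then have "2 * degree H + 1 = 2 * K" by linarith
    then show False by presburger
  qed
  then have "[:- a 0, 1:] ^ K dvd ?J 0" using H(1) by (simp add: interpolates_def)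
  then have "[:- a 0, 1:] dvd ?J 0"
    using dvd_trans[OF dvd_power] \<open>K > 0\<close> by blast
  then have "F 0 0 = 0"
    using poly_jet_node[OF \<open>K > 0\<close>] by (simp add: poly_eq_0_iff_dvd[symmetric])
  then show ?thesis using e by (simp add: F_def sqrt_jet_def)
qed

section \<open>Size and denominators of the binomial coefficients of K - 1/2\<close>

lemma gbinomial_minus_half:
  "real (Suc s) * (- 1 / 2 gchoose Suc s) = - (real s + 1 / 2) * (- 1 / 2 gchoose s :: real)"
  using gbinomial_mult_1[of "- 1 / 2 :: real" s] by (simp add: algebra_simps)

lemma gbinomial_half_Suc:
  "(real (Suc K) - 1 / 2 gchoose Suc s) = (real K - 1 / 2 gchoose s) + (real K - 1 / 2 gchoose Suc s)"
  using gbinomial_Suc_Suc[of "real K - 1 / 2" s] by (simp add: algebra_simps)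

text \<open>Pascal's rule doubles the bound when K grows by 1; for K = 0 the ratios of consecutive
  coefficients have absolute value below 1.\<close>

lemma gbinomial_half_bound: "\<bar>real K - 1 / 2 gchoose s\<bar> \<le> 2 ^ K"
proof (induction K arbitrary: s)
  case 0
  show ?case
  proof (induction s)
    case (Suc s)
    have "real (Suc s) * \<bar>- 1 / 2 gchoose Suc s :: real\<bar> = \<bar>real (Suc s) * (- 1 / 2 gchoose Suc s)\<bar>"
      by (simp only: abs_mult abs_of_nat)
    also have "\<dots> = (real s + 1 / 2) * \<bar>- 1 / 2 gchoose s\<bar>"
      unfolding gbinomial_minus_half by (simp add: abs_mult)
    also have "\<dots> \<le> real (Suc s) * 1" using Suc by (intro mult_mono) auto
    finally show ?case by simp
  qed simp
next
  case (Suc K)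
  show ?case
  proof (cases s)
    case (Suc s')
    have "\<bar>real (Suc K) - 1 / 2 gchoose s\<bar> \<le> \<bar>real K - 1 / 2 gchoose s'\<bar> + \<bar>real K - 1 / 2 gchoose Suc s'\<bar>"
      unfolding Suc gbinomial_half_Suc by (rule abs_triangle_ineq)
    also have "\<dots> \<le> 2 ^ Suc K" using Suc.IH[of s'] Suc.IH[of "Suc s'"] by simp
    finally show ?thesis .
  qed (simp del: power_Suc)
qed

text \<open>Both sides satisfy the same first-order recursion in \<open>s\<close>. This is the case
  K = 0 of \<open>gbinomial_half_Ints\<close>.\<close>

lemma gbinomial_minus_half_central: "4 ^ s * (- 1 / 2 gchoose s :: real) = (- 1) ^ s * real (2 * s choose s)"
proof (induction s)
  case (Suc s)
  have "Suc s * (2 * Suc s choose Suc s) = 2 * (2 * s + 1) * (2 * s choose s)"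
  proof -
    have a: "Suc s * (2 * Suc s choose Suc s) = (2 * s + 2) * (2 * s + 1 choose s)"
      using Suc_times_binomial_eq[of "2 * s + 1" s] by (simp add: mult.commute)
    have b: "Suc s * (2 * s + 1 choose Suc s) = (2 * s + 1) * (2 * s choose s)"
      using Suc_times_binomial_eq[of "2 * s" s] by (simp add: mult.commute)
    have c: "2 * s + 1 choose s = 2 * s + 1 choose Suc s"
      using binomial_symmetric[of s "2 * s + 1"] by simp
    show ?thesis unfolding a c using b by (simp add: algebra_simps)
  qed
  then have "real (Suc s) * real (2 * Suc s choose Suc s) = 2 * (2 * real s + 1) * real (2 * s choose s)"
    by (metis (mono_tags, opaque_lifting) of_nat_1 of_nat_add of_nat_mult of_nat_numeral)
  then have "real (Suc s) * ((- 1) ^ Suc s * real (2 * Suc s choose Suc s))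
      = (- 1) ^ Suc s * (2 * (2 * real s + 1) * real (2 * s choose s))"
    by (metis mult.left_commute)
  moreover have "real (Suc s) * (4 ^ Suc s * (- 1 / 2 gchoose Suc s :: real))
      = - 2 * (2 * real s + 1) * (4 ^ s * (- 1 / 2 gchoose s))"
  proof -
    have "real (Suc s) * (4 ^ Suc s * (- 1 / 2 gchoose Suc s :: real)) =
        4 * 4 ^ s * (real (Suc s) * (- 1 / 2 gchoose Suc s))" by (simp only: power_Suc mult_ac)
    then show ?thesis unfolding gbinomial_minus_half by (simp add: algebra_simps)
  qed
  ultimately have "real (Suc s) * (4 ^ Suc s * (- 1 / 2 gchoose Suc s :: real))
      = real (Suc s) * ((- 1) ^ Suc s * real (2 * Suc s choose Suc s))"
    unfolding Suc by (simp only:) (simp add: algebra_simps del: binomial_Suc_Suc)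
  then show ?case by (simp only: mult_cancel_left of_nat_eq_0_iff) simp
qed simp

lemma gbinomial_half_Ints: "4 ^ s * (real K - 1 / 2 gchoose s) \<in> \<int>"
proof (induction K arbitrary: s)
  case 0
  show ?case using gbinomial_minus_half_central[of s] by simp
next
  case (Suc K)
  show ?case
  proof (cases s)
    case (Suc s')
    have "4 ^ s * (real (Suc K) - 1 / 2 gchoose s) =
        4 * (4 ^ s' * (real K - 1 / 2 gchoose s')) + 4 ^ Suc s' * (real K - 1 / 2 gchoose Suc s')"
      unfolding Suc gbinomial_half_Suc by (simp add: algebra_simps)
    also have "\<dots> \<in> \<int>" by (intro Ints_add Ints_mult Suc.IH) simp
    finally show ?thesis .
  qed simp
qed

text \<open>The Taylor coefficients are those of z^m. A polynomial of such low degree is its own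
  interpolant, and its coefficient of degree i + j + k - 1 > m is zero.\<close>

lemma divdiff_monomial_eq_0:
  assumes "a 1 \<noteq> a 0" "a 2 \<noteq> a 0" "a 2 \<noteq> a 1"
    and "i \<le> K" "j \<le> K" "k \<le> K" "Suc m < i + j + k"
  shows "divdiff a (\<lambda>l s. real (m choose s) * a l ^ (m - s)) i j k = 0"
proof -
  let ?J = "\<lambda>l. jet (a l) (\<lambda>s. real (m choose s) * a l ^ (m - s))"
  \<comment> \<open>With \<open>K + Suc m\<close> terms the jet reaches past both the degree
    \<open>m\<close> and the truncation order \<open>K\<close>.\<close>
  have "[:0, 1:] ^ m = ?J l (K + Suc m)" for l
  proof -
    have "[:0, 1:] ^ m = ([:- a l, 1:] + [:a l:]) ^ m" by simp
    also have "\<dots> = (\<Sum>s\<le>m. of_nat (m choose s) * [:- a l, 1:] ^ s * [:a l:] ^ (m - s))"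
      by (rule binomial_ring)
    also have "\<dots> = (\<Sum>s\<le>m. smult (real (m choose s) * a l ^ (m - s)) ([:- a l, 1:] ^ s))"
      by (intro sum.cong refl) (simp add: of_nat_poly poly_const_pow mult_ac)
    also have "\<dots> = ?J l (K + Suc m)"
      unfolding jet_def by (rule sum.mono_neutral_left) (auto simp: not_le)
    finally show ?thesis .
  qed
  then have "[:- a l, 1:] ^ K dvd ?J l K - [:0, 1:] ^ m" for l
    using jet_trunc_dvd[of K "K + Suc m" "a l" "\<lambda>s. real (m choose s) * a l ^ (m - s)"] by simp
  then have d: "[:- a l, 1:] ^ p dvd [:0, 1:] ^ m - ?J l K" if "p \<le> K" for l p
    using that by (subst dvd_diff_commute) (rule power_le_dvd)
  have H: "interpolates a (\<lambda>l. ?J l K) i j k ([:0, 1:] ^ m)"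
    unfolding interpolates_def using assms(4-)
    by (intro conjI d) (auto simp: coeff_eq_0 degree_power_eq)
  moreover have "coeff ([:0, 1:] ^ m :: real poly) (i + j + k - 1) = 0"
    using assms(7) by (intro coeff_eq_0) (simp add: degree_power_eq)
  moreover have "0 < i + j + k" using assms(7) by linarith
  ultimately show ?thesis using interpolates_coeff[OF assms(1-6) _ H] by simp
qed

text \<open>The factor \<open>sqrt (1 + x * a l)\<close> turns the jet into the true Taylor
  coefficients of (1 + x z)^(K - 1/2). In the expansion by powers of z all monomials of degree below
  \<open>n\<close> drop out, and the tail is dominated by a geometric series of ratio 2 A x <=
  1/2.\<close>

lemma divdiff_sqrt_bound:
  fixes a :: "nat \<Rightarrow> real" and x A :: real and K :: nat
  defines "F \<equiv> \<lambda>l s. sqrt (1 + x * a l) * sqrt_jet K x (1 + x * a l) s"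
  assumes distinct: "\<bar>a 1 - a 0\<bar> \<ge> 1" "\<bar>a 2 - a 0\<bar> \<ge> 1" "\<bar>a 2 - a 1\<bar> \<ge> 1"
    and A: "A \<ge> 1" "\<And>l. l < 3 \<Longrightarrow> \<bar>a l\<bar> \<le> A" and x: "x > 0" "4 * A * x \<le> 1"
    and ijk: "i \<le> K" "j \<le> K" "k \<le> K" "i + j + k = Suc n"
  shows "\<bar>divdiff a F i j k\<bar> \<le> 2 ^ (K + n + 2) * (2 * A * x) ^ n"
proof -
  define c where "c m = (real K - 1 / 2 gchoose m) * x ^ m" for m
  define G where "G m l s = real (m choose s) * a l ^ (m - s)" for m l s
  have small: "\<bar>x * a l\<bar> < 1" if "l < 3" for l
  proof -
    have "\<bar>x * a l\<bar> \<le> x * A" using A(2)[OF that] x by (simp add: abs_mult)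
    also have "\<dots> < 1" using A(1) x mult_pos_pos[of A x] by (simp add: mult_ac)
    finally show ?thesis .
  qed
  have "(\<lambda>m. c m * G m l s) sums F l s" if "l < 3" "s < K" for l s
  proof -
    define \<beta> where "\<beta> = real K - 1 / 2"
    have pos: "1 + x * a l > 0" using small[OF that(1)] by linarith
    \<comment> \<open>The Taylor coefficient of order \<open>s\<close> contains (1 + x a l)^(\<beta>
      - s). Its binomial series, regrouped by trinomial revision, is the termwise Taylor coefficient
      of the series in z, whose terms with m < s vanish.\<close>
    have "(\<lambda>m. (\<beta> - real s gchoose m) * (x * a l) ^ m) sums (1 + x * a l) powr (\<beta> - real s)"
      using gen_binomial_real[of "x * a l" "\<beta> - real s"] small[OF that(1)] by simp
    from sums_mult[OF this, of "(\<beta> gchoose s) * x ^ s"]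
    have "(\<lambda>m. (\<beta> gchoose s) * x ^ s * ((\<beta> - real s gchoose m) * (x * a l) ^ m)) sums
        ((\<beta> gchoose s) * x ^ s * (1 + x * a l) powr (\<beta> - real s))" .
    moreover have "(\<beta> gchoose s) * x ^ s * ((\<beta> - real s gchoose m) * (x * a l) ^ m) = c (m + s) * G (m + s) l s" for m
      using gbinomial_trinomial_revision[of s "m + s" \<beta>]
      by (simp add: c_def G_def \<beta>_def binomial_gbinomial power_add power_mult_distrib mult_ac)
    moreover have "(1 + x * a l) powr (\<beta> - real s) = sqrt (1 + x * a l) * (1 + x * a l) ^ (K - 1 - s)"
    proof -
      have "\<beta> - real s = 1 / 2 + real (K - 1 - s)" using that(2) by (simp add: \<beta>_def of_nat_diff)
      then show ?thesis using pos by (simp add: powr_add powr_half_sqrt powr_realpow)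
    qed
    ultimately have "(\<lambda>m. c (m + s) * G (m + s) l s) sums F l s"
      by (simp add: F_def sqrt_jet_def \<beta>_def mult_ac)
    then show ?thesis
      by (subst (asm) sums_iff_shift) (simp add: G_def sum.neutral binomial_eq_0)
  qed
  then have "(\<lambda>m. c m * divdiff a (G m) i j k) sums divdiff a F i j k"
    using ijk by (intro divdiff_sums) auto
  moreover have "c m * divdiff a (G m) i j k = 0" if "m < n" for m
  proof -
    have "divdiff a (G m) i j k = 0"
      unfolding G_def using distinct ijk that by (intro divdiff_monomial_eq_0[of a i K j k m]) auto
    then show ?thesis by simp
  qed
  ultimately have sums: "(\<lambda>m. c (m + n) * divdiff a (G (m + n)) i j k) sums divdiff a F i j k"
    by (subst sums_iff_shift) (simp add: sum.neutral)
  define r where "r = 2 * A * x"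
  have r: "0 < r" "r \<le> 1 / 2" using A(1) x by (auto simp: r_def)
  have coeff_bound: "norm (c m * divdiff a (G m) i j k) \<le> 2 ^ (K + n + 1) * r ^ m" for m
  proof -
    have "\<bar>G m l s\<bar> \<le> (2 * A) ^ m" if "l < 3" for l s
    proof (cases "s \<le> m")
      case True
      have "\<bar>G m l s\<bar> = real (m choose s) * \<bar>a l\<bar> ^ (m - s)" by (simp add: G_def abs_mult power_abs)
      also have "\<dots> \<le> 2 ^ m * A ^ m"
      proof (intro mult_mono)
        show "real (m choose s) \<le> 2 ^ m"
          using binomial_le_pow2[of m s] by (metis of_nat_le_iff of_nat_numeral of_nat_power)
        have "\<bar>a l\<bar> ^ (m - s) \<le> A ^ (m - s)" using A(2)[OF that] by (intro power_mono) auto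
        also have "\<dots> \<le> A ^ m" using A(1) by (intro power_increasing) auto
        finally show "\<bar>a l\<bar> ^ (m - s) \<le> A ^ m" .
      qed auto
      finally show ?thesis by (simp add: power_mult_distrib)
    qed (use A(1) in \<open>simp add: G_def binomial_eq_0\<close>)
    then have "\<bar>divdiff a (G m) i j k\<bar> \<le> 2 ^ (i + j + k) * (2 * A) ^ m"
      using distinct ijk A(1) by (intro divdiff_bound[where K = K]) auto
    moreover have "\<bar>c m\<bar> \<le> 2 ^ K * x ^ m"
      using gbinomial_half_bound[of K m] x by (auto simp: c_def abs_mult power_abs intro: mult_right_mono)
    ultimately have "\<bar>c m\<bar> * \<bar>divdiff a (G m) i j k\<bar> \<le> (2 ^ K * x ^ m) * (2 ^ (i + j + k) * (2 * A) ^ m)"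
      using x by (intro mult_mono) auto
    also have "\<dots> = 2 ^ (K + n + 1) * r ^ m"
      by (simp add: ijk(4) r_def power_mult_distrib power_add mult_ac)
    finally show ?thesis by (simp add: abs_mult)
  qed
  have "(\<lambda>m. 2 ^ (K + n + 1) * r ^ n * r ^ m) sums (2 ^ (K + n + 1) * r ^ n * (1 / (1 - r)))"
    using r by (intro sums_mult geometric_sums) auto
  with sums have "norm (divdiff a F i j k) \<le> 2 ^ (K + n + 1) * r ^ n * (1 / (1 - r))"
  proof (rule norm_sums_le)
    show "norm (c (m + n) * divdiff a (G (m + n)) i j k) \<le> 2 ^ (K + n + 1) * r ^ n * r ^ m" for m
      using coeff_bound[of "m + n"] by (simp add: power_add mult_ac)
  qed
  also have "\<dots> \<le> 2 ^ (K + n + 1) * r ^ n * 2"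
    using r by (intro mult_left_mono) (auto simp: field_simps)
  finally show ?thesis by (simp add: r_def)
qed

section \<open>Simultaneous approximation and simultaneous Pell equations\<close>

lemma sqrt_jet_bound:
  assumes "0 < x" "x \<le> 1" "\<bar>e\<bar> \<le> 2"
  shows "\<bar>sqrt_jet K x e s\<bar> \<le> 4 ^ K"
proof -
  have "\<bar>e\<bar> ^ (K - 1 - s) \<le> 2 ^ (K - 1 - s)" using assms(3) by (intro power_mono) auto
  also have "\<dots> \<le> (2::real) ^ K" by (intro power_increasing) auto
  finally have "\<bar>e\<bar> ^ (K - 1 - s) \<le> 2 ^ K" .
  moreover have "x ^ s \<le> 1" using assms(1,2) by (intro power_le_one) auto
  ultimately have "\<bar>real K - 1 / 2 gchoose s\<bar> * x ^ s * \<bar>e\<bar> ^ (K - 1 - s) \<le> 2 ^ K * 1 * 2 ^ K"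
    using gbinomial_half_bound[of K s] assms(1) by (intro mult_mono) auto
  also have "\<dots> = (4::real) ^ K" by (simp flip: power_mult_distrib)
  finally show ?thesis
    unfolding sqrt_jet_def abs_mult power_abs using assms(1) by simp
qed

text \<open>For x = 1/N the factors \<open>x ^ s\<close> and \<open>e ^ (K - 1 - s)\<close> together
  have the denominator N^(K - 1), whatever \<open>s\<close> is; the power of 4 serves the binomial
  coefficient.\<close>

lemma sqrt_jet_Ints:
  fixes N b :: int
  assumes "N > 0" "s < K"
  shows "4 ^ K * real_of_int N ^ (K - 1) * sqrt_jet K (1 / real_of_int N) (1 + 1 / real_of_int N * real_of_int b) s \<in> \<int>"
proof -
  have K: "K - 1 = s + (K - 1 - s)" "K = s + (K - s)" using assms by auto
  have e: "1 + 1 / real_of_int N * real_of_int b = real_of_int (N + b) / real_of_int N"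
    using assms(1) by (simp add: field_simps)
  have "real_of_int N ^ (K - 1) = real_of_int N ^ s * real_of_int N ^ (K - 1 - s)"
    by (subst K(1)) (rule power_add)
  moreover have "(4::real) ^ K = 4 ^ s * 4 ^ (K - s)"
    by (subst K(2)) (rule power_add)
  ultimately have "4 ^ K * real_of_int N ^ (K - 1) * sqrt_jet K (1 / real_of_int N) (1 + 1 / real_of_int N * real_of_int b) s
      = 4 ^ (K - s) * (4 ^ s * (real K - 1 / 2 gchoose s)) * real_of_int (N + b) ^ (K - 1 - s)"
    using assms(1) unfolding sqrt_jet_def e power_divide by simp
  also have "\<dots> \<in> \<int>" by (intro Ints_mult Ints_power gbinomial_half_Ints) auto
  finally show ?thesis .
qed

text \<open>Up to factors exponential in k, a suitable divided difference formed with the integers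
  \<open>t l\<close> is a nonzero rational of denominator N^k. Replacing \<open>t l\<close> by q
  times the square root changes it by the order of \<mu> and leaves q times a quantity of size
  N^(-3k). \<open>C\<close> depends on the nodes only, and k stays free to be adapted to q.\<close>

lemma simultaneous_sqrt_approximation:
  fixes a :: "nat \<Rightarrow> int"
  assumes distinct: "a 1 \<noteq> a 0" "a 2 \<noteq> a 0" "a 2 \<noteq> a 1"
  shows "\<exists>A C :: real. C \<ge> 1 \<and> (\<forall>(N::int) (t :: nat \<Rightarrow> int) q \<mu> k. real_of_int N \<ge> A \<longrightarrow> t 0 \<noteq> 0 \<longrightarrow> q \<ge> 0 \<longrightarrow>
      (\<forall>l<3. \<bar>real_of_int (t l) - q * sqrt (1 + real_of_int (a l) / real_of_int N)\<bar> \<le> \<mu>) \<longrightarrow>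
      1 \<le> C ^ Suc k * (q / real_of_int N ^ (2 * k) + real_of_int N ^ k * \<mu>))"
proof -
  define \<Delta> where "\<Delta> = \<bar>real_of_int ((a 1 - a 0) * (a 2 - a 0) * (a 2 - a 1))\<bar>"
  define A where "A = 1 + \<bar>real_of_int (a 0)\<bar> + \<bar>real_of_int (a 1)\<bar> + \<bar>real_of_int (a 2)\<bar>"
  \<comment> \<open>All factors occur to the power K = k + 1: 4 for the binomial denominators,
    \<open>\<Delta> ^ 3\<close> for at most 3K node divisions, 32 = 2^3 * 4 = 2^5 for the two size
    estimates, and \<open>(2 * A) ^ 3\<close> for the tail of the series.\<close>
  define C where "C = 4 * \<Delta> ^ 3 * 32 * (2 * A) ^ 3"
  have "A \<ge> 1" by (simp add: A_def)
  have A_bound: "\<bar>real_of_int (a l)\<bar> \<le> A" if "l < 3" for l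
  proof -
    have "l = 0 \<or> l = 1 \<or> l = 2" using that by auto
    then show ?thesis unfolding A_def by auto
  qed
  have "(a 1 - a 0) * (a 2 - a 0) * (a 2 - a 1) \<noteq> 0" using distinct by simp
  then have "\<Delta> \<ge> 1" unfolding \<Delta>_def by linarith
  show ?thesis
  proof (rule exI[of _ "4 * A"], rule exI[of _ C], intro conjI allI impI)
    have "1 * 1 \<le> \<Delta> ^ 3 * (2 * A) ^ 3"
      using \<open>\<Delta> \<ge> 1\<close> \<open>A \<ge> 1\<close> by (intro mult_mono one_le_power) auto
    then show "C \<ge> 1" unfolding C_def by (simp add: mult_ac)
  next
    fix N :: int and t :: "nat \<Rightarrow> int" and q \<mu> :: real and k :: nat
    assume N: "real_of_int N \<ge> 4 * A" and t0: "t 0 \<noteq> 0" and "q \<ge> 0"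
      and "\<forall>l<3. \<bar>real_of_int (t l) - q * sqrt (1 + real_of_int (a l) / real_of_int N)\<bar> \<le> \<mu>"
    then have approx: "\<bar>real_of_int (t l) - q * sqrt (1 + real_of_int (a l) / real_of_int N)\<bar> \<le> \<mu>" if "l < 3" for l
      using that by blast
    define K where "K = Suc k"
    define x where "x = 1 / real_of_int N"
    define b where "b l = real_of_int (a l)" for l
    define S where "S l s = sqrt_jet K x (1 + x * b l) s" for l s
    define F where "F l s = real_of_int (t l) * S l s" for l s
    define G where "G l s = sqrt (1 + x * b l) * S l s" for l s
    have Npos: "N > 0" and "real_of_int N > 0" using N \<open>A \<ge> 1\<close> by linarith+
    have "real_of_int N \<ge> 1" using Npos by linarith
    have x: "x > 0" "4 * A * x \<le> 1" "x \<le> 1"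
      using N \<open>real_of_int N \<ge> 1\<close> by (auto simp: x_def field_simps)
    have e: "\<bar>1 + x * b l\<bar> \<le> 2" "1 + x * b l > 0" if "l < 3" for l
    proof -
      have "\<bar>x * b l\<bar> \<le> x * A" using A_bound[OF that] x by (simp add: abs_mult b_def)
      also have "\<dots> < 1" using x \<open>A \<ge> 1\<close> mult_pos_pos[of A x] by (simp add: mult_ac)
      finally show "\<bar>1 + x * b l\<bar> \<le> 2" "1 + x * b l > 0" by linarith+
    qed
    have "\<mu> \<ge> 0" using approx[of 0] by linarith
    have far: "\<bar>b 1 - b 0\<bar> \<ge> 1" "\<bar>b 2 - b 0\<bar> \<ge> 1" "\<bar>b 2 - b 1\<bar> \<ge> 1"
      using distinct unfolding b_def by linarith+
    \<comment> \<open>The candidates are the multiplicities of \<open>divdiff_sqrt_nonzero\<close>,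
      with sums 3K, 3K - 1 and 3K - 2; the smallest sum is 3k + 1, which still gives n >=
      3k.\<close>
    have "\<exists>i j n. i \<le> K \<and> j \<le> K \<and> i + j + K = Suc n \<and> 3 * k \<le> n \<and> Suc n \<le> 3 * K \<and> divdiff b F i j K \<noteq> 0"
    proof (rule ccontr)
      assume none: "\<not> ?thesis"
      have vanish: "divdiff b F i j K = 0" if "i \<le> K" "j \<le> K" "i + j + K > 3 * k" for i j
      proof -
        define n where "n = i + j + K - 1"
        have "i + j + K = Suc n" "3 * k \<le> n" "Suc n \<le> 3 * K"
          using that by (auto simp: n_def K_def)
        then show ?thesis using none that(1,2) by blast
      qed
      have "real_of_int (t 0) = 0"
      proof (rule divdiff_sqrt_nonzero[where a = b and t = "\<lambda>l. real_of_int (t l)" and x = x and K = K])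
        show "divdiff b (\<lambda>l s. real_of_int (t l) * sqrt_jet K x (1 + x * b l) s) K K K = 0"
          "divdiff b (\<lambda>l s. real_of_int (t l) * sqrt_jet K x (1 + x * b l) s) (K - 1) K K = 0"
          "divdiff b (\<lambda>l s. real_of_int (t l) * sqrt_jet K x (1 + x * b l) s) (K - 1) (K - 1) K = 0"
          using vanish[of K K] vanish[of "K - 1" K] vanish[of "K - 1" "K - 1"]
          by (simp_all add: F_def[abs_def] S_def[abs_def] K_def)
      qed (use distinct x e[of 0] in \<open>auto simp: b_def K_def\<close>)
      then show False using t0 by simp
    qed
    then obtain i j n where ij: "i \<le> K" "j \<le> K" "i + j + K = Suc n" "3 * k \<le> n" "Suc n \<le> 3 * K"
      and nz: "divdiff b F i j K \<noteq> 0" by blast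
    define E where "E = 4 ^ K * real_of_int N ^ k"
    have E: "E > 0" using Npos by (simp add: E_def)
    have "E * ((b 1 - b 0) * (b 2 - b 0) * (b 2 - b 1)) ^ (i + j + K) * divdiff b F i j K \<in> \<int>"
    proof (rule divdiff_Ints)
      fix l s assume "s < K"
      have "E * S l s \<in> \<int>"
        unfolding E_def S_def x_def b_def using sqrt_jet_Ints[OF Npos \<open>s < K\<close>, of "a l"] by (simp add: K_def)
      then have "real_of_int (t l) * (E * S l s) \<in> \<int>" by (rule Ints_mult[OF Ints_of_int])
      then show "E * F l s \<in> \<int>" by (simp add: F_def mult_ac)
    qed (use distinct ij in \<open>auto simp: b_def\<close>)
    moreover have "E * ((b 1 - b 0) * (b 2 - b 0) * (b 2 - b 1)) ^ (i + j + K) * divdiff b F i j K \<noteq> 0"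
      using nz E distinct by (simp add: b_def)
    ultimately have "1 \<le> \<bar>E * ((b 1 - b 0) * (b 2 - b 0) * (b 2 - b 1)) ^ (i + j + K) * divdiff b F i j K\<bar>"
      by (rule Ints_nonzero_abs_ge1)
    also have "\<dots> = E * \<Delta> ^ Suc n * \<bar>divdiff b F i j K\<bar>"
      using E by (simp add: abs_mult power_abs \<Delta>_def b_def ij(3) del: power_Suc)
    also have "\<dots> \<le> E * \<Delta> ^ (3 * K) * \<bar>divdiff b F i j K\<bar>"
      using E \<open>\<Delta> \<ge> 1\<close> ij(5) by (intro mult_right_mono mult_left_mono power_increasing) auto
    also have "\<bar>divdiff b F i j K\<bar> \<le> 32 ^ K * \<mu> + q * (32 ^ K * (2 * A) ^ (3 * K) * x ^ (3 * k))"
    proof -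
      \<comment> \<open>\<open>F\<close> differs from \<open>q\<close> times the exact Taylor
        coefficients \<open>G\<close> only by the approximation errors, so the two parts are
        estimated separately.\<close>
      have "\<bar>divdiff b (\<lambda>l s. F l s - q * G l s) i j K\<bar> \<le> 2 ^ (i + j + K) * (\<mu> * 4 ^ K)"
      proof (rule divdiff_bound[OF far, where K = K])
        fix l s :: nat assume "l < 3"
        have "F l s - q * G l s = (real_of_int (t l) - q * sqrt (1 + real_of_int (a l) / real_of_int N)) * S l s"
          by (simp add: F_def G_def x_def b_def algebra_simps)
        then show "\<bar>F l s - q * G l s\<bar> \<le> \<mu> * 4 ^ K"
          using approx[OF \<open>l < 3\<close>] sqrt_jet_bound[OF x(1,3) e(1)[OF \<open>l < 3\<close>], of K s] \<open>\<mu> \<ge> 0\<close>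
          by (simp add: abs_mult S_def mult_mono)
      qed (use ij \<open>\<mu> \<ge> 0\<close> in auto)
      also have "\<dots> \<le> 2 ^ (3 * K) * (\<mu> * 4 ^ K)"
        using ij(3,5) \<open>\<mu> \<ge> 0\<close> by (intro mult_right_mono power_increasing) auto
      also have "\<dots> = 32 ^ K * \<mu>"
        by (simp only: power_mult mult.left_commute[of _ \<mu>] mult.commute[of _ \<mu>] flip: power_mult_distrib) simp
      finally have 1: "\<bar>divdiff b (\<lambda>l s. F l s - q * G l s) i j K\<bar> \<le> 32 ^ K * \<mu>" .
      have "\<bar>divdiff b G i j K\<bar> \<le> 2 ^ (K + n + 2) * (2 * A * x) ^ n"
        unfolding G_def S_def using far \<open>A \<ge> 1\<close> A_bound x ij
        by (intro divdiff_sqrt_bound) (auto simp: b_def)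
      also have "\<dots> \<le> 2 ^ (5 * K) * (2 * A * x) ^ (3 * k)"
        using ij x \<open>A \<ge> 1\<close> by (intro mult_mono power_increasing power_decreasing) (auto simp: K_def)
      also have "\<dots> \<le> 2 ^ (5 * K) * ((2 * A) ^ (3 * K) * x ^ (3 * k))"
        unfolding power_mult_distrib[of "2 * A" x] using x \<open>A \<ge> 1\<close>
        by (intro mult_left_mono mult_right_mono power_increasing) (auto simp: K_def)
      also have "\<dots> = 32 ^ K * (2 * A) ^ (3 * K) * x ^ (3 * k)"
        by (simp add: power_mult)
      finally have 2: "\<bar>divdiff b G i j K\<bar> \<le> 32 ^ K * (2 * A) ^ (3 * K) * x ^ (3 * k)" .
      have "divdiff b F i j K = divdiff b (\<lambda>l s. F l s - q * G l s) i j K + q * divdiff b G i j K"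
        by (simp add: divdiff_diff_scale)
      then have "\<bar>divdiff b F i j K\<bar> \<le> \<bar>divdiff b (\<lambda>l s. F l s - q * G l s) i j K\<bar> + q * \<bar>divdiff b G i j K\<bar>"
        using abs_triangle_ineq \<open>q \<ge> 0\<close> by (metis abs_mult abs_of_nonneg)
      also have "\<dots> \<le> 32 ^ K * \<mu> + q * (32 ^ K * (2 * A) ^ (3 * K) * x ^ (3 * k))"
        using 1 2 \<open>q \<ge> 0\<close> by (intro add_mono mult_left_mono)
      finally show ?thesis .
    qed
    also have "32 ^ K * \<mu> \<le> 32 ^ K * (2 * A) ^ (3 * K) * \<mu>"
    proof -
      have "1 \<le> (2 * A) ^ (3 * K)" using \<open>A \<ge> 1\<close> by (intro one_le_power) auto
      then have "32 ^ K * 1 * \<mu> \<le> 32 ^ K * (2 * A) ^ (3 * K) * \<mu>"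
        using \<open>\<mu> \<ge> 0\<close> by (intro mult_right_mono mult_left_mono) auto
      then show ?thesis by simp
    qed
    finally have "1 \<le> E * \<Delta> ^ (3 * K) * (32 ^ K * (2 * A) ^ (3 * K) * \<mu> + q * (32 ^ K * (2 * A) ^ (3 * K) * x ^ (3 * k)))"
      using E \<open>\<Delta> \<ge> 1\<close> by (simp add: mult_left_mono)
    also have "\<dots> = C ^ K * (real_of_int N ^ k * \<mu> + q * (real_of_int N ^ k * x ^ (3 * k)))"
    proof -
      have "C ^ K = 4 ^ K * \<Delta> ^ (3 * K) * 32 ^ K * (2 * A) ^ (3 * K)"
        unfolding C_def by (simp only: power_mult_distrib power_mult)
      then show ?thesis unfolding E_def by (simp only: algebra_simps)
    qed
    also have "real_of_int N ^ k * x ^ (3 * k) = 1 / real_of_int N ^ (2 * k)"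
      using Npos by (simp add: x_def power_divide field_simps flip: power_add)
    finally show "1 \<le> C ^ Suc k * (q / real_of_int N ^ (2 * k) + real_of_int N ^ k * \<mu>)"
      by (simp add: K_def add.commute)
  qed
qed

text \<open>Take the least k with M^k > 4 C b x. The first summand is then below 1/4. By minimality
  x is at least of order M^k, so the second is at most a constant times (C^2 / N)^k <= 2^(-k), which
  is small because a large x forces a large k.\<close>

lemma intermediate_exponent:
  fixes C N b c :: real
  assumes "C \<ge> 1" "N \<ge> 2 * C\<^sup>2" "b > 0" "c > 0"
  shows "\<exists>B. \<forall>x>B. \<exists>k. C ^ Suc k * (b * x / N ^ (2 * k) + N ^ k * (c / x)) < 1"
proof -
  define M where "M = N\<^sup>2 / C"
  have "C\<^sup>2 \<ge> C" using assms(1) by (simp add: power2_eq_square)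
  then have "N \<ge> 2 * C" using assms(2) by linarith
  then have N: "N \<ge> 2" using assms(1) by linarith
  have "2 * C \<le> N * N" using \<open>N \<ge> 2 * C\<close> N mult_mono[of 1 N "2 * C" N] assms(1) by simp
  then have M: "M \<ge> 2" using assms(1) by (simp add: M_def field_simps power2_eq_square)
  \<comment> \<open>Chosen so that \<open>\<Gamma>\<close> < (N / C^2)^k makes the second summand
    less than 1/2.\<close>
  define \<Gamma> where "\<Gamma> = 8 * C\<^sup>2 * b * c * M"
  obtain k0 where k0: "\<Gamma> < 2 ^ k0" using real_arch_pow[of 2 \<Gamma>] by auto
  show ?thesis
  proof (rule exI, intro allI impI)
    fix x assume x: "x > M ^ k0 / (4 * C * b)"
    then have "M ^ k0 < 4 * C * b * x" using assms by (simp add: field_simps)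
    have "x > 0" using x M assms by (smt (verit) divide_nonneg_pos mult_pos_pos zero_le_power)
    obtain k' where "4 * C * b * x < M ^ k'" using real_arch_pow[of M] M by auto
    then obtain k where k: "4 * C * b * x < M ^ k" and least: "\<And>k'. k' < k \<Longrightarrow> M ^ k' \<le> 4 * C * b * x"
      using exists_least_iff[of "\<lambda>k. 4 * C * b * x < M ^ k"] by (metis not_le)
    have "k0 < k"
    proof (rule ccontr)
      assume "\<not> k0 < k"
      then have "M ^ k \<le> M ^ k0" using M by (intro power_increasing) auto
      then show False using k \<open>M ^ k0 < 4 * C * b * x\<close> by linarith
    qed
    then have "M ^ (k - 1) \<le> 4 * C * b * x" using least by simp
    then have "M ^ k \<le> M * (4 * C * b * x)"
      using M \<open>k0 < k\<close> by (cases k) (auto intro: mult_left_mono)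
    have "C ^ Suc k * (b * x / N ^ (2 * k)) = C * b * x / M ^ k"
      using assms(1) N unfolding power_mult M_def power_divide by simp
    also have "\<dots> < 1 / 4" using k M by (simp add: field_simps)
    finally have 1: "C ^ Suc k * (b * x / N ^ (2 * k)) < 1 / 4" .
    have "\<Gamma> < 2 ^ k"
      using k0 power_increasing[of k0 k "2::real"] \<open>k0 < k\<close> by linarith
    also have "\<dots> \<le> (N / C\<^sup>2) ^ k"
      using assms by (intro power_mono) (auto simp: field_simps)
    finally have "8 * C\<^sup>2 * b * c * M * (C * N) ^ k < (N / C\<^sup>2) ^ k * (C * N) ^ k"
      using assms(1) N unfolding \<Gamma>_def by (intro mult_strict_right_mono) auto
    also have "\<dots> = M ^ k"
      using assms(1) by (simp add: M_def flip: power_mult_distrib) (simp add: power2_eq_square)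
    also have "\<dots> \<le> M * (4 * C * b * x)" by fact
    finally have "(4 * C * b * M) * (2 * C * c * (C * N) ^ k) < (4 * C * b * M) * x"
      by (simp add: power2_eq_square mult_ac)
    then have "2 * (C * c * (C * N) ^ k) < x" using assms M by (simp add: mult_less_cancel_left)
    then have 2: "C ^ Suc k * (N ^ k * (c / x)) < 1 / 2"
      using \<open>x > 0\<close> by (simp add: field_simps power_mult_distrib)
    show "\<exists>k. C ^ Suc k * (b * x / N ^ (2 * k) + N ^ k * (c / x)) < 1"
      using 1 2 by (intro exI[of _ k]) (simp only: distrib_left)
  qed
qed

section \<open>Finiteness for simultaneous Pell equations\<close>

lemma pell_sqrt_approximation:
  fixes D e x y :: int
  assumes "D > 0" "x > 0" "y \<ge> 0" "y\<^sup>2 = D * x\<^sup>2 + e"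
  shows "\<bar>real_of_int y - real_of_int x * sqrt (real_of_int D)\<bar> \<le> \<bar>real_of_int e\<bar> / real_of_int x"
proof -
  define s where "s = real_of_int x * sqrt (real_of_int D)"
  have "sqrt (real_of_int D) \<ge> 1" using assms(1) by simp
  then have s: "s \<ge> real_of_int x" using assms(2) unfolding s_def by simp
  have "s\<^sup>2 = real_of_int (D * x\<^sup>2)" using assms(1) by (simp add: s_def power_mult_distrib mult.commute)
  then have "(real_of_int y)\<^sup>2 - s\<^sup>2 = real_of_int e"
    using assms(4) by (metis add_diff_cancel_left' of_int_diff of_int_power)
  \<comment> \<open>Here e factors as (y - s) (y + s), and the second factor is at least x.\<close>
  then have "\<bar>real_of_int y - s\<bar> * \<bar>real_of_int y + s\<bar> = \<bar>real_of_int e\<bar>"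
    by (metis abs_mult mult.commute square_diff_square_factored power2_eq_square)
  moreover have "\<bar>real_of_int y + s\<bar> \<ge> real_of_int x" using s assms(3) by simp
  ultimately have "\<bar>real_of_int y - s\<bar> * real_of_int x \<le> \<bar>real_of_int e\<bar>"
    by (metis abs_ge_zero mult_left_mono)
  then show ?thesis using assms(2) by (simp add: s_def pos_le_divide_eq)
qed

text \<open>The hypotheses on \<open>e1\<close> and \<open>e2\<close> say that the three nodes are
  distinct. One large solution fixes N and hence a bound \<open>B\<close>; a second solution beyond
  \<open>B\<close> contradicts the gap inequality.\<close>

theorem simultaneous_pell_finite:
  fixes D1 D2 e1 e2 :: int
  assumes D: "D1 > 0" "D2 > 0" and "e1 \<noteq> 0" "e2 \<noteq> 0" "e1 * D2 \<noteq> e2 * D1"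
  shows "finite {x. \<exists>y z. y\<^sup>2 = D1 * x\<^sup>2 + e1 \<and> z\<^sup>2 = D2 * x\<^sup>2 + e2}" (is "finite ?S")
proof (rule ccontr)
  assume "infinite ?S"
  have large: "\<exists>x y z. real_of_int x > B \<and> y \<ge> 0 \<and> z \<ge> 0 \<and> y\<^sup>2 = D1 * x\<^sup>2 + e1 \<and> z\<^sup>2 = D2 * x\<^sup>2 + e2" for B
  proof (rule ccontr)
    assume none: "\<not> ?thesis"
    have "?S \<subseteq> {- \<lceil>B\<rceil>..\<lceil>B\<rceil>}"
    proof
      fix x assume "x \<in> ?S"
      then obtain y z where "y\<^sup>2 = D1 * x\<^sup>2 + e1" "z\<^sup>2 = D2 * x\<^sup>2 + e2" by blast
      then have "\<not> real_of_int \<bar>x\<bar> > B"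
        using none by (metis abs_ge_zero power2_abs)
      then show "x \<in> {- \<lceil>B\<rceil>..\<lceil>B\<rceil>}" by (simp add: abs_le_iff) linarith
    qed
    then show False using \<open>infinite ?S\<close> finite_subset by blast
  qed
  define a where "a l = (if l = 0 then 0 else if l = Suc 0 then e1 * D2 else e2 * D1)" for l :: nat
  have distinct: "a 1 \<noteq> a 0" "a 2 \<noteq> a 0" "a 2 \<noteq> a 1" using assms by (auto simp: a_def)
  obtain A C where "C \<ge> 1" and gap: "\<forall>(N::int) (t :: nat \<Rightarrow> int) q \<mu> k. real_of_int N \<ge> A \<longrightarrow> t 0 \<noteq> 0 \<longrightarrow> q \<ge> 0 \<longrightarrow>
      (\<forall>l<3. \<bar>real_of_int (t l) - q * sqrt (1 + real_of_int (a l) / real_of_int N)\<bar> \<le> \<mu>) \<longrightarrow>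
      1 \<le> C ^ Suc k * (q / real_of_int N ^ (2 * k) + real_of_int N ^ k * \<mu>)"
    using simultaneous_sqrt_approximation[OF distinct] by blast
  obtain x0 y0 z0 where x0: "real_of_int x0 > max (max A (2 * C\<^sup>2)) 1" and "y0 \<ge> 0" "z0 \<ge> 0"
    and y0: "y0\<^sup>2 = D1 * x0\<^sup>2 + e1" and z0: "z0\<^sup>2 = D2 * x0\<^sup>2 + e2"
    using large by blast
  define N where "N = D1 * D2 * x0\<^sup>2"
  have "x0 > 1" using x0 by simp
  have "x0 \<le> N"
  proof -
    have "1 * x0 \<le> (D1 * D2 * x0) * x0"
      using D \<open>x0 > 1\<close> by (intro mult_right_mono) (auto simp: int_one_le_iff_zero_less)
    then show ?thesis by (simp add: N_def power2_eq_square mult_ac)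
  qed
  then have "real_of_int x0 \<le> real_of_int N" by simp
  then have N: "real_of_int N \<ge> A" "real_of_int N \<ge> 2 * C\<^sup>2" "N > 0"
    using x0 \<open>x0 > 1\<close> \<open>x0 \<le> N\<close> by linarith+
  define r1 r2 where "r1 = sqrt (real_of_int D1)" and "r2 = sqrt (real_of_int D2)"
  have r: "r1 > 0" "r2 > 0" "r1 * r1 = real_of_int D1" "r2 * r2 = real_of_int D2"
    using D by (simp_all add: r1_def r2_def)
  \<comment> \<open>The node is chosen so that 1 + e1 D2 / N = (D1 x0^2 + e1) / (D1 x0^2), whose
    numerator is the square of y0.\<close>
  have \<theta>1: "sqrt (1 + real_of_int (a 1) / real_of_int N) = real_of_int y0 / (real_of_int x0 * r1)"
  proof -
    have "1 + real_of_int (a 1) / real_of_int N = real_of_int (D1 * x0\<^sup>2 + e1) / (real_of_int D1 * (real_of_int x0)\<^sup>2)"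
      using D \<open>x0 > 1\<close> by (simp add: a_def N_def field_simps)
    also have "\<dots> = (real_of_int y0 / (real_of_int x0 * r1))\<^sup>2"
      unfolding y0[symmetric] using r by (simp add: power_divide power_mult_distrib power2_eq_square mult_ac)
    finally show ?thesis using r \<open>y0 \<ge> 0\<close> \<open>x0 > 1\<close> by simp
  qed
  have \<theta>2: "sqrt (1 + real_of_int (a 2) / real_of_int N) = real_of_int z0 / (real_of_int x0 * r2)"
  proof -
    have "1 + real_of_int (a 2) / real_of_int N = real_of_int (D2 * x0\<^sup>2 + e2) / (real_of_int D2 * (real_of_int x0)\<^sup>2)"
      using D \<open>x0 > 1\<close> by (simp add: a_def N_def field_simps)
    also have "\<dots> = (real_of_int z0 / (real_of_int x0 * r2))\<^sup>2"
      unfolding z0[symmetric] using r by (simp add: power_divide power_mult_distrib power2_eq_square mult_ac)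
    finally show ?thesis using r \<open>z0 \<ge> 0\<close> \<open>x0 > 1\<close> by simp
  qed
  \<comment> \<open>\<open>b\<close> clears denominators: b times the square roots at the three
    nodes gives \<open>b\<close> itself, y0 D2 sqrt D1 and z0 D1 sqrt D2. After multiplication by x,
    the last two are approximated through y and z, and \<open>c\<close> dominates the errors
    multiplied by x.\<close>
  define b where "b = real_of_int (x0 * D1 * D2)"
  define c where "c = 1 + real_of_int (y0 * D2 * \<bar>e1\<bar>) + real_of_int (z0 * D1 * \<bar>e2\<bar>)"
  have "b > 0" using D \<open>x0 > 1\<close> by (simp add: b_def)
  have parts: "y0 * D2 * \<bar>e1\<bar> \<ge> 0" "z0 * D1 * \<bar>e2\<bar> \<ge> 0" using D \<open>y0 \<ge> 0\<close> \<open>z0 \<ge> 0\<close> by simp_all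
  then have c: "c > 0" "real_of_int (y0 * D2 * \<bar>e1\<bar>) \<le> c" "real_of_int (z0 * D1 * \<bar>e2\<bar>) \<le> c"
    unfolding c_def by linarith+
  obtain B where B: "\<And>x. x > B \<Longrightarrow> \<exists>k. C ^ Suc k * (b * x / real_of_int N ^ (2 * k) + real_of_int N ^ k * (c / x)) < 1"
    using intermediate_exponent[OF \<open>C \<ge> 1\<close> N(2) \<open>b > 0\<close> c(1)] by blast
  obtain x y z where x: "real_of_int x > max B 0" and "y \<ge> 0" "z \<ge> 0"
    and y: "y\<^sup>2 = D1 * x\<^sup>2 + e1" and z: "z\<^sup>2 = D2 * x\<^sup>2 + e2"
    using large by blast
  have "x > 0" using x by simp
  define t where "t l = (if l = 0 then x0 * D1 * D2 * x else if l = Suc 0 then y0 * D2 * y else z0 * D1 * z)" for l :: nat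
  have close: "\<bar>real_of_int (t l) - b * real_of_int x * sqrt (1 + real_of_int (a l) / real_of_int N)\<bar> \<le> c / real_of_int x"
    if "l < 3" for l
  proof -
    have "l = 0 \<or> l = 1 \<or> l = 2" using that by auto
    then consider "l = 0" | "l = 1" | "l = 2" by blast
    then show ?thesis
    proof cases
      case 1
      then show ?thesis using c(1) \<open>x > 0\<close> by (simp add: t_def a_def b_def)
    next
      case 2
      have "b * real_of_int x * (real_of_int y0 / (real_of_int x0 * r1)) = real_of_int (y0 * D2) * (real_of_int x * r1)"
        using r(1) \<open>x0 > 1\<close> by (simp add: b_def field_simps flip: r(3))
      then have "\<bar>real_of_int (t l) - b * real_of_int x * sqrt (1 + real_of_int (a l) / real_of_int N)\<bar>
          = \<bar>real_of_int (y0 * D2) * (real_of_int y - real_of_int x * r1)\<bar>"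
        unfolding 2 \<theta>1 by (simp add: t_def algebra_simps)
      also have "\<dots> = real_of_int (y0 * D2) * \<bar>real_of_int y - real_of_int x * r1\<bar>"
        using D \<open>y0 \<ge> 0\<close> by (simp add: abs_mult)
      also have "\<dots> \<le> real_of_int (y0 * D2) * (\<bar>real_of_int e1\<bar> / real_of_int x)"
        using pell_sqrt_approximation[OF D(1) \<open>x > 0\<close> \<open>y \<ge> 0\<close> y] D \<open>y0 \<ge> 0\<close>
        by (intro mult_left_mono) (auto simp: r1_def)
      also have "\<dots> = real_of_int (y0 * D2 * \<bar>e1\<bar>) / real_of_int x" by simp
      also have "\<dots> \<le> c / real_of_int x" using c(2) \<open>x > 0\<close> by (intro divide_right_mono) auto
      finally show ?thesis .
    next
      case 3
      have "b * real_of_int x * (real_of_int z0 / (real_of_int x0 * r2)) = real_of_int (z0 * D1) * (real_of_int x * r2)"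
        using r(2) \<open>x0 > 1\<close> by (simp add: b_def field_simps flip: r(4))
      then have "\<bar>real_of_int (t l) - b * real_of_int x * sqrt (1 + real_of_int (a l) / real_of_int N)\<bar>
          = \<bar>real_of_int (z0 * D1) * (real_of_int z - real_of_int x * r2)\<bar>"
        unfolding 3 \<theta>2 by (simp add: t_def algebra_simps)
      also have "\<dots> = real_of_int (z0 * D1) * \<bar>real_of_int z - real_of_int x * r2\<bar>"
        using D \<open>z0 \<ge> 0\<close> by (simp add: abs_mult)
      also have "\<dots> \<le> real_of_int (z0 * D1) * (\<bar>real_of_int e2\<bar> / real_of_int x)"
        using pell_sqrt_approximation[OF D(2) \<open>x > 0\<close> \<open>z \<ge> 0\<close> z] D \<open>z0 \<ge> 0\<close>
        by (intro mult_left_mono) (auto simp: r2_def)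
      also have "\<dots> = real_of_int (z0 * D1 * \<bar>e2\<bar>) / real_of_int x" by simp
      also have "\<dots> \<le> c / real_of_int x" using c(3) \<open>x > 0\<close> by (intro divide_right_mono) auto
      finally show ?thesis .
    qed
  qed
  obtain k where "C ^ Suc k * (b * real_of_int x / real_of_int N ^ (2 * k) + real_of_int N ^ k * (c / real_of_int x)) < 1"
    using B[of "real_of_int x"] x by auto
  moreover have "1 \<le> C ^ Suc k * (b * real_of_int x / real_of_int N ^ (2 * k) + real_of_int N ^ k * (c / real_of_int x))"
    using D \<open>x0 > 1\<close> \<open>x > 0\<close> \<open>b > 0\<close> by (intro gap[rule_format, OF N(1) _ _ close]) (auto simp: t_def)
  ultimately show False by linarith
qed

section \<open>Lucas sequences\<close>

text \<open>One step of the recurrence multiplies this quadratic form by \<open>Q\<close>.\<close>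

lemma lucasU_norm_form:
  "(lucasU P Q (Suc n))\<^sup>2 - P * lucasU P Q (Suc n) * lucasU P Q n + Q * (lucasU P Q n)\<^sup>2 = Q ^ n"
proof (induction n)
  case (Suc n)
  have "(lucasU P Q (Suc (Suc n)))\<^sup>2 - P * lucasU P Q (Suc (Suc n)) * lucasU P Q (Suc n) + Q * (lucasU P Q (Suc n))\<^sup>2
      = Q * ((lucasU P Q (Suc n))\<^sup>2 - P * lucasU P Q (Suc n) * lucasU P Q n + Q * (lucasU P Q n)\<^sup>2)"
    by (simp add: power2_eq_square algebra_simps)
  then show ?case using Suc by simp
qed simp

text \<open>Completing the square in \<open>lucasU_norm_form\<close>; the witness for
  \<open>v\<close> is the companion term V_n = 2 U_(n+1) - P U_n.\<close>

lemma lucasU_pell: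
  assumes "\<bar>Q\<bar> = 1" "u \<in> range (lucasU P Q)"
  obtains v e where "e \<in> {4, - 4}" "v\<^sup>2 = (P\<^sup>2 - 4 * Q) * u\<^sup>2 + e"
proof -
  obtain n where n: "u = lucasU P Q n" using assms(2) by blast
  have "(2 * lucasU P Q (Suc n) - P * u)\<^sup>2 = (P\<^sup>2 - 4 * Q) * u\<^sup>2 + 4 * Q ^ n"
    using lucasU_norm_form[of P Q n] unfolding n by (simp add: power2_eq_square algebra_simps)
  moreover have "\<bar>Q ^ n\<bar> = 1" using assms(1) by (simp add: power_abs)
  then have "4 * Q ^ n \<in> {4, - 4}" by (auto simp: abs_if split: if_splits)
  ultimately show ?thesis using that by blast
qed

lemma infinite_intersection_discriminant:
  assumes "\<bar>Q1\<bar> = 1" "\<bar>Q2\<bar> = 1" "P1\<^sup>2 - 4 * Q1 > 0" "P2\<^sup>2 - 4 * Q2 > 0"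
    and "infinite (range (lucasU P1 Q1) \<inter> range (lucasU P2 Q2))"
  shows "P1\<^sup>2 - 4 * Q1 = P2\<^sup>2 - 4 * Q2"
proof (rule ccontr)
  define D1 D2 where "D1 = P1\<^sup>2 - 4 * Q1" and "D2 = P2\<^sup>2 - 4 * Q2"
  define S where "S e1 e2 = {x. \<exists>y z. y\<^sup>2 = D1 * x\<^sup>2 + e1 \<and> z\<^sup>2 = D2 * x\<^sup>2 + e2}" for e1 e2
  assume "P1\<^sup>2 - 4 * Q1 \<noteq> P2\<^sup>2 - 4 * Q2"
  \<comment> \<open>The products e1 D2 and e2 D1 differ: for equal signs of e1 and e2 because D1 and
    D2 differ, for opposite signs because both discriminants are positive.\<close>
  then have "finite (S e1 e2)" if "e1 \<in> {4, - 4}" "e2 \<in> {4, - 4}" for e1 e2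
    unfolding S_def using that assms(3,4) by (intro simultaneous_pell_finite) (auto simp: D1_def D2_def)
  then have "finite (\<Union>e1\<in>{4, - 4}. \<Union>e2\<in>{4, - 4}. S e1 e2)" by simp
  moreover have "range (lucasU P1 Q1) \<inter> range (lucasU P2 Q2) \<subseteq> (\<Union>e1\<in>{4, - 4}. \<Union>e2\<in>{4, - 4}. S e1 e2)"
  proof
    fix u assume "u \<in> range (lucasU P1 Q1) \<inter> range (lucasU P2 Q2)"
    then obtain v1 e1 v2 e2 where "e1 \<in> {4, - 4}" "v1\<^sup>2 = D1 * u\<^sup>2 + e1" "e2 \<in> {4, - 4}" "v2\<^sup>2 = D2 * u\<^sup>2 + e2"
      unfolding D1_def D2_def using lucasU_pell[OF assms(1)] lucasU_pell[OF assms(2)] by (metis IntE)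
    then show "u \<in> (\<Union>e1\<in>{4, - 4}. \<Union>e2\<in>{4, - 4}. S e1 e2)" unfolding S_def by blast
  qed
  ultimately show False using assms(5) finite_subset by blast
qed

section \<open>The Fibonacci case and the equation between discriminants\<close>

lemma lucasU_3_1: "lucasU 3 1 n = lucasU 1 (- 1) (2 * n)"
proof (induction n rule: induct_nat_012)
  case (ge2 n)
  then show ?case by (simp add: numeral_2_eq_2)
qed (simp_all add: numeral_2_eq_2)

lemma infinite_range_lucasU_3_1: "infinite (range (lucasU 3 1))"
proof -
  have "lucasU 3 1 n \<ge> 0 \<and> lucasU 3 1 n < lucasU 3 1 (Suc n)" for n
    by (induction n) auto
  then have "strict_mono (lucasU 3 1)" by (simp add: strict_mono_Suc_iff)
  then show ?thesis by (simp add: range_inj_infinite strict_mono_imp_inj_on)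
qed

text \<open>Equal \<open>Q\<close> would force equal positive \<open>P\<close>. So the signs of
  \<open>Q\<close> differ and the squares of \<open>P\<close> differ by 8, which leaves only 9 and
  1.\<close>

lemma discriminant_eq_iff:
  fixes P1 Q1 P2 Q2 :: int
  assumes "(P1, Q1) \<noteq> (P2, Q2)" "P1 > 0" "P2 > 0" "\<bar>Q1\<bar> = 1" "\<bar>Q2\<bar> = 1"
  shows "P1\<^sup>2 - 4 * Q1 = P2\<^sup>2 - 4 * Q2 \<longleftrightarrow> {(P1, Q1), (P2, Q2)} = {(1, - 1), (3, 1)}"
proof
  have eight: "p = 3 \<and> p' = 1" if "p > 0" "p' > 0" "p\<^sup>2 - 4 * 1 = p'\<^sup>2 - 4 * (- 1)" for p p' :: int
  proof -
    have prod: "(p - p') * (p + p') = 8" using that(3) by (simp add: power2_eq_square algebra_simps)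
    then have "p - p' > 0" using that(1,2) by (smt (verit) mult_nonpos_nonneg)
    then have "p + p' \<le> 8" using prod that(1,2) mult_right_mono[of 1 "p - p'" "p + p'"] by simp
    then have "p \<in> {1..8}" "p' \<in> {1..8}" using that(1,2) by auto
    then have "p \<in> {1,2,3,4,5,6,7,8}" "p' \<in> {1,2,3,4,5,6,7,8}" by auto
    then show ?thesis using that(3) by auto
  qed
  assume eq: "P1\<^sup>2 - 4 * Q1 = P2\<^sup>2 - 4 * Q2"
  have "Q1 = 1 \<or> Q1 = - 1" "Q2 = 1 \<or> Q2 = - 1" using assms(4,5) by linarith+
  moreover have "Q1 \<noteq> Q2" using eq assms(1-3) by (auto simp: power2_eq_iff)
  ultimately show "{(P1, Q1), (P2, Q2)} = {(1, - 1), (3, 1)}"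
    using eight[of P1 P2] eight[of P2 P1] eq assms(2,3) by auto
qed (auto simp: doubleton_eq_iff)

theorem theorem7:
  fixes P1 Q1 P2 Q2 :: int
  assumes "(P1, Q1) \<noteq> (P2, Q2)"
    and "\<not> degenerate P1 Q1" and "\<not> degenerate P2 Q2"
    and "P1 > 0" and "P2 > 0" and "\<bar>Q1\<bar> = 1" and "\<bar>Q2\<bar> = 1"
  shows "(infinite (range (lucasU P1 Q1) \<inter> range (lucasU P2 Q2))
            \<longleftrightarrow> P1^2 - 4*Q1 = P2^2 - 4*Q2)
       \<and> (P1^2 - 4*Q1 = P2^2 - 4*Q2
            \<longleftrightarrow> {(P1, Q1), (P2, Q2)} = {(1, -1), (3, 1)})
       \<and> ({(P1, Q1), (P2, Q2)} = {(1, -1), (3, 1)}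
            \<longrightarrow> range (lucasU P1 Q1) \<inter> range (lucasU P2 Q2) = range (lucasU 3 1))"
proof -
  \<comment> \<open>For Q = 1 the degenerate pairs with P > 0 are P = 1 and P = 2, exactly those
    with P^2 - 4 not positive.\<close>
  have pos: "P\<^sup>2 - 4 * Q > 0" if "\<not> degenerate P Q" "P > 0" "\<bar>Q\<bar> = 1" for P Q :: int
  proof (cases "Q = 1")
    case True
    then have "P \<ge> 3" using that by (auto simp: degenerate_def)
    then have "3\<^sup>2 \<le> P\<^sup>2" by (intro power_mono) auto
    then show ?thesis using True by simp
  next
    case False
    then have "Q = - 1" using that(3) by linarith
    then show ?thesis using zero_le_power2[of P] by linarith
  qed
  have sub: "range (lucasU 3 1) \<subseteq> range (lucasU 1 (- 1))"
    by (auto simp: lucasU_3_1)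
  have int: "range (lucasU P1 Q1) \<inter> range (lucasU P2 Q2) = range (lucasU 3 1)"
    if "{(P1, Q1), (P2, Q2)} = {(1, -1), (3, 1)}"
    using that sub by (auto simp: doubleton_eq_iff)
  note disc = discriminant_eq_iff[OF assms(1,4-7)]
  have inf: "infinite (range (lucasU P1 Q1) \<inter> range (lucasU P2 Q2)) \<longleftrightarrow> P1\<^sup>2 - 4 * Q1 = P2\<^sup>2 - 4 * Q2"
  proof
    assume "infinite (range (lucasU P1 Q1) \<inter> range (lucasU P2 Q2))"
    then show "P1\<^sup>2 - 4 * Q1 = P2\<^sup>2 - 4 * Q2"
      by (rule infinite_intersection_discriminant[OF assms(6,7) pos[OF assms(2,4,6)] pos[OF assms(3,5,7)]])
  next
    assume "P1\<^sup>2 - 4 * Q1 = P2\<^sup>2 - 4 * Q2"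
    then have "{(P1, Q1), (P2, Q2)} = {(1, - 1), (3, 1)}" by (rule disc[THEN iffD1])
    then have "range (lucasU P1 Q1) \<inter> range (lucasU P2 Q2) = range (lucasU 3 1)" by (rule int)
    then show "infinite (range (lucasU P1 Q1) \<inter> range (lucasU P2 Q2))"
      using infinite_range_lucasU_3_1 by simp
  qed
  show ?thesis by (intro conjI impI inf disc int)
qed

end
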